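(* Let $I$ be a nonempty set, let $(n_i\mid i\in I)$ be a bounded family of positive integers, let $(G_i\mid i\in I)$ be a family of groups, let $n$ be a positive integer, and let $G$ be a group. Then $\mathrm M^{\oplus}_n(G^{\sqcup0})$ belongs to the variety of biases generated by $\{\mathrm M^{\oplus}_{n_i}(G_i^{\sqcup0})\mid i\in I\}$ if and only if $n\le n_o$ for some $o\in I$ and $G$ belongs to the variety of groups generated by $\{G_i\wr\mathfrak S_{\lfloor n_i/n\rfloor}\mid i\in I,\ n\le n_i\}$.
   Context: A semigroup $S$ is inverse if every $x\in S$ has a unique $x^{-1}$ with $x=xx^{-1}x$ and $x^{-1}=x^{-1}xx^{-1}$. Put $\mathbf d(x)=x^{-1}x$, $\mathbf r(x)=xx^{-1}$; $\operatorname{Idp}S$ is the set of idempotents; the natural ordering is $x\le y$ iff $x=y\,\mathbf d(x)$. In an inverse semigroup with zero, $x,y$ are orthogonal if $x^{-1}y=xy^{-1}=0$. A Boolean inverse semigroup is an inverse semigroup $S$ with zero such that $\operatorname{Idp}S$ is a generalized Boolean algebra and any two orthogonal $x,y$ have a join $x\oplus y$ for the natural ordering. On a Boolean inverse semigroup define $x\oslash y=(\mathbf r(x)\smallsetminus\mathbf r(y))\,x\,(\mathbf d(x)\smallsetminus\mathbf d(y))$ and $x\triangledown y=(x\oslash y)\oplus y$. Boolean inverse semigroups, viewed as algebras $(S,0,{}^{-1},\cdot,\oslash,\triangledown)$, are exactly the models of a finite set of identities; these algebras are called biases, so a bias is the same as a Boolean inverse semigroup. Bias homomorphisms are exactly the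 semigroup homomorphisms $f$ with $f(0)=0$ and $f(x\oplus y)=f(x)\oplus f(y)$ for orthogonal $x,y$. A variety of biases is the class of all biases satisfying some set of identities in this similarity type. For a positive integer $n$ and a Boolean inverse semigroup $S$, a generalized rook matrix of order $n$ over $S$ is a matrix $(x_{i,j})_{1\le i,j\le n}$ over $S$ with $x_{i,j}^{-1}x_{i,k}=x_{j,i}x_{k,i}^{-1}=0$ whenever $j\ne k$; these form a Boolean inverse semigroup $\mathrm M^{\oplus}_n(S)$ under $(xy)_{i,j}=\bigoplus_kx_{i,k}y_{k,j}$. For a group $G$, $G^{\sqcup0}=G\cup\{0\}$ is $G$ with a new zero. $\mathfrak S_k$ is the symmetric group on $\{1,\dots,k\}$ and $G\wr\mathfrak S_k=G^k\rtimes\mathfrak S_k$ is the wreath product for the natural action. $\lfloor x\rfloor$ is the largest integer $\le x$. *)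

theory Defs
  imports "HOL-Algebra.Sym_Groups" "HOL-Algebra.Product_Groups" "HOL-Algebra.Lattice"
begin

section \<open>Inverse semigroups with zero\<close>

text \<open>Only the multiplication and the zero are stored; inversion and the bias operations
  are determined by them.\<close>

record 'a semigroup0 = "'a partial_object" +
  smul :: "'a \<Rightarrow> 'a \<Rightarrow> 'a"  (infixl \<open>\<cdot>\<index>\<close> 70)
  szero :: "'a"  (\<open>\<zero>\<^sub>s\<index>\<close>)

locale semigroup_with_zero =
  fixes S :: "'a semigroup0" (structure)
  assumes smul_closed: "\<lbrakk>x \<in> carrier S; y \<in> carrier S\<rbrakk> \<Longrightarrow> x \<cdot> y \<in> carrier S"
    and smul_assoc: "\<lbrakk>x \<in> carrier S; y \<in> carrier S; z \<in> carrier S\<rbrakk>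
      \<Longrightarrow> (x \<cdot> y) \<cdot> z = x \<cdot> (y \<cdot> z)"
    and szero_closed: "\<zero>\<^sub>s \<in> carrier S"
    and szero_left: "x \<in> carrier S \<Longrightarrow> \<zero>\<^sub>s \<cdot> x = \<zero>\<^sub>s"
    and szero_right: "x \<in> carrier S \<Longrightarrow> x \<cdot> \<zero>\<^sub>s = \<zero>\<^sub>s"

definition is_sinv :: "'a semigroup0 \<Rightarrow> 'a \<Rightarrow> 'a \<Rightarrow> bool" where
  "is_sinv S x y \<longleftrightarrow> x = x \<cdot>\<^bsub>S\<^esub> y \<cdot>\<^bsub>S\<^esub> x \<and> y = y \<cdot>\<^bsub>S\<^esub> x \<cdot>\<^bsub>S\<^esub> y"

locale inverse_semigroup_with_zero = semigroup_with_zero +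
  assumes ex1_sinv: "x \<in> carrier S \<Longrightarrow> \<exists>!y. y \<in> carrier S \<and> is_sinv S x y"

definition sinv :: "'a semigroup0 \<Rightarrow> 'a \<Rightarrow> 'a" where
  "sinv S x = (THE y. y \<in> carrier S \<and> is_sinv S x y)"

definition dom_idp :: "'a semigroup0 \<Rightarrow> 'a \<Rightarrow> 'a" where
  "dom_idp S x = sinv S x \<cdot>\<^bsub>S\<^esub> x"

definition rng_idp :: "'a semigroup0 \<Rightarrow> 'a \<Rightarrow> 'a" where
  "rng_idp S x = x \<cdot>\<^bsub>S\<^esub> sinv S x"

definition Idp :: "'a semigroup0 \<Rightarrow> 'a set" where
  "Idp S = {e \<in> carrier S. e \<cdot>\<^bsub>S\<^esub> e = e}"

definition natural_order :: "'a semigroup0 \<Rightarrow> 'a gorder" where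
  "natural_order S =
    \<lparr>carrier = carrier S, eq = (=), le = (\<lambda>x y. x = y \<cdot>\<^bsub>S\<^esub> dom_idp S x)\<rparr>"

definition idp_order :: "'a semigroup0 \<Rightarrow> 'a gorder" where
  "idp_order S = (natural_order S)\<lparr>carrier := Idp S\<rparr>"

definition orthogonal :: "'a semigroup0 \<Rightarrow> 'a \<Rightarrow> 'a \<Rightarrow> bool" where
  "orthogonal S x y \<longleftrightarrow>
    sinv S x \<cdot>\<^bsub>S\<^esub> y = \<zero>\<^sub>s\<^bsub>S\<^esub> \<and> x \<cdot>\<^bsub>S\<^esub> sinv S y = \<zero>\<^sub>s\<^bsub>S\<^esub>"


section \<open>Boolean inverse semigroups\<close>

text \<open>A generalized Boolean algebra has a bottom but need not have a top element.\<close>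

definition is_difference :: "'a gorder \<Rightarrow> 'a \<Rightarrow> 'a \<Rightarrow> 'a \<Rightarrow> bool" where
  "is_difference L a b c \<longleftrightarrow>
    c \<in> carrier L \<and> (a \<sqinter>\<^bsub>L\<^esub> b) \<squnion>\<^bsub>L\<^esub> c = a \<and> b \<sqinter>\<^bsub>L\<^esub> c = \<bottom>\<^bsub>L\<^esub>"

locale generalized_boolean_algebra = lattice L + weak_partial_order_bottom L
  for L :: "'a gorder" (structure) +
  assumes meet_join_distrib: "\<lbrakk>x \<in> carrier L; y \<in> carrier L; z \<in> carrier L\<rbrakk>
      \<Longrightarrow> x \<sqinter> (y \<squnion> z) = (x \<sqinter> y) \<squnion> (x \<sqinter> z)"
    and ex_difference: "\<lbrakk>x \<in> carrier L; y \<in> carrier L\<rbrakk> \<Longrightarrow> \<exists>z. is_difference L x y z"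

locale boolean_inverse_semigroup = inverse_semigroup_with_zero +
  assumes idp_boolean: "generalized_boolean_algebra (idp_order S)"
    and ex_orthogonal_join: "\<lbrakk>x \<in> carrier S; y \<in> carrier S; orthogonal S x y\<rbrakk>
      \<Longrightarrow> \<exists>z. least (natural_order S) z (Upper (natural_order S) {x, y})"

definition idp_diff :: "'a semigroup0 \<Rightarrow> 'a \<Rightarrow> 'a \<Rightarrow> 'a" where
  "idp_diff S e f = (THE g. is_difference (idp_order S) e f g)"

text \<open>The orthogonal join is the join for the natural ordering; both operations below are
  meaningful only when that join exists.\<close>

definition ojoin :: "'a semigroup0 \<Rightarrow> 'a \<Rightarrow> 'a \<Rightarrow> 'a" where
  "ojoin S x y = x \<squnion>\<^bsub>natural_order S\<^esub> y"

definition ojoin_family :: "'a semigroup0 \<Rightarrow> 'k set \<Rightarrow> ('k \<Rightarrow> 'a) \<Rightarrow> 'a" where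
  "ojoin_family S K x = (SSUP\<^bsub>natural_order S\<^esub> k:K. x k)"


section \<open>Biases: terms, identities and varieties\<close>

definition skew_diff :: "'a semigroup0 \<Rightarrow> 'a \<Rightarrow> 'a \<Rightarrow> 'a" where
  "skew_diff S x y =
    idp_diff S (rng_idp S x) (rng_idp S y) \<cdot>\<^bsub>S\<^esub> x \<cdot>\<^bsub>S\<^esub>
    idp_diff S (dom_idp S x) (dom_idp S y)"

definition skew_add :: "'a semigroup0 \<Rightarrow> 'a \<Rightarrow> 'a \<Rightarrow> 'a" where
  "skew_add S x y = ojoin S (skew_diff S x y) y"

datatype bias_term =
    BVar nat
  | BZero
  | BInv bias_term
  | BMul bias_term bias_term
  | BDiff bias_term bias_term
  | BAdd bias_term bias_term

primrec bias_eval :: "'a semigroup0 \<Rightarrow> (nat \<Rightarrow> 'a) \<Rightarrow> bias_term \<Rightarrow> 'a" where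
  "bias_eval S v (BVar k) = v k"
| "bias_eval S v BZero = \<zero>\<^sub>s\<^bsub>S\<^esub>"
| "bias_eval S v (BInv s) = sinv S (bias_eval S v s)"
| "bias_eval S v (BMul s t) = bias_eval S v s \<cdot>\<^bsub>S\<^esub> bias_eval S v t"
| "bias_eval S v (BDiff s t) = skew_diff S (bias_eval S v s) (bias_eval S v t)"
| "bias_eval S v (BAdd s t) = skew_add S (bias_eval S v s) (bias_eval S v t)"

definition bias_satisfies :: "'a semigroup0 \<Rightarrow> (bias_term \<times> bias_term) set \<Rightarrow> bool" where
  "bias_satisfies S \<Sigma> \<longleftrightarrow>
    (\<forall>(s, t) \<in> \<Sigma>. \<forall>v. range v \<subseteq> carrier S \<longrightarrow> bias_eval S v s = bias_eval S v t)"

definition bias_variety :: "(bias_term \<times> bias_term) set \<Rightarrow> 'a semigroup0 set" where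
  "bias_variety \<Sigma> = {S. boolean_inverse_semigroup S \<and> bias_satisfies S \<Sigma>}"

text \<open>The intersection of all varieties containing \<open>K\<close>. The members of \<open>K\<close> and those of the
  variety may have different element types.\<close>

definition bias_variety_generated :: "'a semigroup0 set \<Rightarrow> 'b semigroup0 set" where
  "bias_variety_generated K = \<Inter> {bias_variety \<Sigma> | \<Sigma>. \<forall>S \<in> K. bias_satisfies S \<Sigma>}"


section \<open>Varieties of groups\<close>

datatype group_term =
    GVar nat
  | GOne
  | GInv group_term
  | GMul group_term group_term

primrec group_eval :: "'a monoid \<Rightarrow> (nat \<Rightarrow> 'a) \<Rightarrow> group_term \<Rightarrow> 'a" where
  "group_eval G v (GVar k) = v k"
| "group_eval G v GOne = \<one>\<^bsub>G\<^esub>"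
| "group_eval G v (GInv s) = inv\<^bsub>G\<^esub> (group_eval G v s)"
| "group_eval G v (GMul s t) = group_eval G v s \<otimes>\<^bsub>G\<^esub> group_eval G v t"

definition group_satisfies :: "'a monoid \<Rightarrow> (group_term \<times> group_term) set \<Rightarrow> bool" where
  "group_satisfies G \<Sigma> \<longleftrightarrow>
    (\<forall>(s, t) \<in> \<Sigma>. \<forall>v. range v \<subseteq> carrier G \<longrightarrow> group_eval G v s = group_eval G v t)"

definition group_variety :: "(group_term \<times> group_term) set \<Rightarrow> 'a monoid set" where
  "group_variety \<Sigma> = {G. group G \<and> group_satisfies G \<Sigma>}"

definition group_variety_generated :: "'a monoid set \<Rightarrow> 'b monoid set" where
  "group_variety_generated K = \<Inter> {group_variety \<Sigma> | \<Sigma>. \<forall>G \<in> K. group_satisfies G \<Sigma>}"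


section \<open>Rook matrices, groups with zero, wreath products\<close>

definition rook_matrix :: "nat \<Rightarrow> 'a semigroup0 \<Rightarrow> (nat \<times> nat \<Rightarrow> 'a) \<Rightarrow> bool" where
  "rook_matrix n S x \<longleftrightarrow> x \<in> ({1..n} \<times> {1..n} \<rightarrow>\<^sub>E carrier S) \<and>
    (\<forall>i \<in> {1..n}. \<forall>j \<in> {1..n}. \<forall>k \<in> {1..n}. j \<noteq> k \<longrightarrow>
      sinv S (x (i, j)) \<cdot>\<^bsub>S\<^esub> x (i, k) = \<zero>\<^sub>s\<^bsub>S\<^esub> \<and>
      x (j, i) \<cdot>\<^bsub>S\<^esub> sinv S (x (k, i)) = \<zero>\<^sub>s\<^bsub>S\<^esub>)"

definition rook_matrices :: "nat \<Rightarrow> 'a semigroup0 \<Rightarrow> (nat \<times> nat \<Rightarrow> 'a) semigroup0" where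
  "rook_matrices n S =
    \<lparr>carrier = {x. rook_matrix n S x},
     smul = (\<lambda>x y. \<lambda>(i, j) \<in> {1..n} \<times> {1..n}.
       ojoin_family S {1..n} (\<lambda>k. x (i, k) \<cdot>\<^bsub>S\<^esub> y (k, j))),
     szero = (\<lambda>(i, j) \<in> {1..n} \<times> {1..n}. \<zero>\<^sub>s\<^bsub>S\<^esub>)\<rparr>"

text \<open>The new zero is \<open>None\<close>.\<close>

definition group0 :: "'a monoid \<Rightarrow> 'a option semigroup0" where
  "group0 G =
    \<lparr>carrier = insert None (Some ` carrier G),
     smul = (\<lambda>x y. case (x, y) of (Some g, Some h) \<Rightarrow> Some (g \<otimes>\<^bsub>G\<^esub> h) | _ \<Rightarrow> None),
     szero = None\<rparr>"

text \<open>The semidirect product of \<open>G\<^sup>k\<close> with the symmetric group, where a permutation \<open>p\<close> sends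
  \<open>(g\<^sub>i)\<^sub>i\<close> to the tuple whose entry at \<open>i\<close> is \<open>g\<close> at the preimage of \<open>i\<close> under \<open>p\<close>.\<close>

definition wreath_sym :: "'a monoid \<Rightarrow> nat \<Rightarrow> ((nat \<Rightarrow> 'a) \<times> (nat \<Rightarrow> nat)) monoid" where
  "wreath_sym G k =
    (let B = product_group {1..k} (\<lambda>_. G) in
     \<lparr>carrier = carrier B \<times> carrier (sym_group k),
      monoid.mult = (\<lambda>(g, p) (h, q).
        (g \<otimes>\<^bsub>B\<^esub> (\<lambda>i \<in> {1..k}. h (inv_into UNIV p i)), p \<otimes>\<^bsub>sym_group k\<^esub> q)),
      one = (\<one>\<^bsub>B\<^esub>, \<one>\<^bsub>sym_group k\<^esub>)\<rparr>)"

end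

theory Submission
  imports Defs
begin

text \<open>The proof replaces rook matrices by partial bijections. A rook matrix \<open>x\<close> of order \<open>n\<close> over
  \<open>G \<union> {0}\<close> acts on \<open>{1..n} \<times> G\<close>: an entry \<open>h\<close> at \<open>(i, j)\<close> sends \<open>(j, u)\<close> to \<open>(i, h u)\<close>. This
  identifies \<open>M\<^sub>n(G\<^sup>0)\<close> with the set of all partial bijections of \<open>{1..n} \<times> G\<close> that commute with the
  right translations of \<open>G\<close>, and under the identification every bias operation becomes a set operation
  on relations. A bias identity therefore holds in \<open>M\<^sub>n(G\<^sup>0)\<close> if and only if it holds for relations
  of this kind (\<open>rook_matrices_satisfies_iff\<close>); the same representation shows that \<open>M\<^sub>n(G\<^sup>0)\<close> is
  a Boolean inverse semigroup. In the same way, the wreath product of \<open>G\<close> with the symmetric group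
  of degree \<open>k\<close> is the group of all permutations of \<open>{1..k} \<times> G\<close> that commute with right
  translations.

  For the direction from groups to biases, fix which entries of the variables of a bias identity
  \<open>s = t\<close> are zero, and let the nonzero ones be distinct group variables. Then \<open>s\<close> and \<open>t\<close> evaluate
  to matrices of group terms. The zero patterns of these two matrices depend on nothing else, so
  \<open>s = t\<close> holds in \<open>M\<^sub>n(G\<^sup>0)\<close> exactly when the two patterns always agree and \<open>G\<close> satisfies a certain
  set of group identities. Suppose \<open>s = t\<close> holds in \<open>M\<^sub>N(H\<^sup>0)\<close>, where \<open>n \<le> N\<close>, and let \<open>k\<close> be the
  integer part of \<open>N / n\<close>. As \<open>n\<close> blocks of size \<open>k\<close> fit into \<open>{1..N}\<close>, the \<open>n \<times> n\<close> matrices over the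
  wreath product \<open>W\<close> of \<open>H\<close> with the symmetric group of degree \<open>k\<close> act as block matrices inside
  \<open>M\<^sub>N(H\<^sup>0)\<close>, so \<open>W\<close> satisfies those group identities (\<open>pattern_identities\<close>), and hence so does
  every group in the variety generated by such wreath products (\<open>rook_satisfies_from_patterns\<close>).

  For the other direction, a group identity \<open>p = q\<close> is turned into a bias identity. One variable \<open>a\<close>
  singles out the set of points that are not in the range of \<open>a\<close> but on which \<open>a\<^sup>n\<^sup>-\<^sup>1\<close>
  is defined. The sets obtained from it by applying \<open>1, a, \<dots>, a\<^sup>n\<^sup>-\<^sup>1\<close> are pairwise disjoint,
  so in \<open>M\<^sub>N(H\<^sup>0)\<close> it has rank at most \<open>N / n\<close> (\<open>card_seed_set\<close>). This set is then shrunk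
  repeatedly to the points whose images under the variables of \<open>p\<close> and \<open>q\<close> and under their inverses
  lie in it again. The rank is at most \<open>N\<close>, so after \<open>N\<close> rounds the set is stable, and these variables
  restrict to permutations of it. They generate a subgroup of a wreath product of degree at most \<open>N / n\<close>, where
  \<open>p = q\<close> holds (\<open>corner_identity_holds\<close>). One number of rounds serves all the generating biases,
  because their orders are bounded. In \<open>M\<^sub>n(G\<^sup>0)\<close> itself, \<open>a\<close> can be the shift \<open>1 \<mapsto> 2 \<mapsto> \<dots> \<mapsto> n\<close>;
  the stable set is then \<open>{1} \<times> G\<close>, on which arbitrary elements of \<open>G\<close> act, so the bias identity
  gives \<open>p = q\<close> in \<open>G\<close> (\<open>corner_identity_reflects\<close>). Finally, the identity that makes the first
  set empty holds in \<open>M\<^sub>N(H\<^sup>0)\<close> for \<open>N < n\<close> and fails in \<open>M\<^sub>n(G\<^sup>0)\<close>, which yields an order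
  that is at least \<open>n\<close>.\<close>

section \<open>Partial bijections and the relational meaning of bias terms\<close>

definition partial_bijection :: "('a \<times> 'a) set \<Rightarrow> bool" where
  "partial_bijection R \<longleftrightarrow> single_valued R \<and> single_valued (R\<inverse>)"

lemma partial_bijectionI:
  assumes "\<And>a b c. (a, b) \<in> R \<Longrightarrow> (a, c) \<in> R \<Longrightarrow> b = c"
    and "\<And>a b c. (a, c) \<in> R \<Longrightarrow> (b, c) \<in> R \<Longrightarrow> a = b"
  shows "partial_bijection R"
  using assms unfolding partial_bijection_def single_valued_def by blast

lemma partial_bijection_right_unique:
  "partial_bijection R \<Longrightarrow> (a, b) \<in> R \<Longrightarrow> (a, c) \<in> R \<Longrightarrow> b = c"
  unfolding partial_bijection_def single_valued_def by blast

lemma partial_bijection_left_unique: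
  "partial_bijection R \<Longrightarrow> (a, c) \<in> R \<Longrightarrow> (b, c) \<in> R \<Longrightarrow> a = b"
  unfolding partial_bijection_def single_valued_def by blast

lemmas partial_bijection_unique = partial_bijection_left_unique partial_bijection_right_unique

lemma partial_bijection_converse: "partial_bijection R \<Longrightarrow> partial_bijection (R\<inverse>)"
  unfolding partial_bijection_def by simp

lemma partial_bijection_relcomp:
  "partial_bijection R \<Longrightarrow> partial_bijection Q \<Longrightarrow> partial_bijection (R O Q)"
  unfolding partial_bijection_def by (simp add: converse_relcomp single_valued_relcomp)

lemma partial_bijection_Un:
  assumes "partial_bijection R" "partial_bijection Q"
    and "Domain R \<inter> Domain Q = {}" "Range R \<inter> Range Q = {}"
  shows "partial_bijection (R \<union> Q)"
proof (rule partial_bijectionI)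
  fix a b c assume "(a, b) \<in> R \<union> Q" "(a, c) \<in> R \<union> Q"
  with assms show "b = c" by (blast dest: partial_bijection_right_unique)
next
  fix a b c assume "(a, c) \<in> R \<union> Q" "(b, c) \<in> R \<union> Q"
  with assms show "a = b" by (blast dest: partial_bijection_left_unique)
qed

lemma partial_bijection_regular: "partial_bijection R \<Longrightarrow> R O R\<inverse> O R = R"
  unfolding partial_bijection_def single_valued_def by fast

text \<open>Uniqueness of inverses in the symmetric inverse semigroup: a chain of three steps through
  \<open>R\<close>, \<open>Q\<close>, \<open>R\<close> that returns the pair \<open>(a, b)\<close> of \<open>R\<close> must run forth and back along this same pair.\<close>

lemma partial_bijection_generalized_inverse:
  assumes R: "partial_bijection R" and Q: "partial_bijection Q"
    and RQR: "R O Q O R = R" and QRQ: "Q O R O Q = Q"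
  shows "Q = R\<inverse>"
proof -
  have *: "B\<inverse> \<subseteq> C" if "partial_bijection B" "B O C O B = B" for B C :: "('b \<times> 'b) set"
  proof
    fix p assume "p \<in> B\<inverse>"
    then obtain a b where p: "p = (b, a)" and ab: "(a, b) \<in> B" by auto
    with that(2) have "(a, b) \<in> B O C O B" by simp
    then obtain c d where "(a, c) \<in> B" "(c, d) \<in> C" "(d, b) \<in> B" by blast
    with ab that(1) show "p \<in> C" unfolding p by (metis partial_bijection_unique)
  qed
  from *[OF R RQR] *[OF Q QRQ] show ?thesis by auto
qed

lemma partial_bijection_dom: "partial_bijection R \<Longrightarrow> R O R\<inverse> = Id_on (Domain R)"
  by (auto dest: partial_bijection_left_unique)

lemma partial_bijection_ran: "partial_bijection R \<Longrightarrow> R\<inverse> O R = Id_on (Range R)"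
  by (auto dest: partial_bijection_right_unique)

lemma partial_bijection_idempotent_iff:
  assumes "partial_bijection R"
  shows "R O R = R \<longleftrightarrow> R \<subseteq> Id"
proof
  assume RR: "R O R = R"
  show "R \<subseteq> Id"
  proof
    fix p assume "p \<in> R"
    then obtain a b c where "p = (a, b)" "(a, b) \<in> R" "(a, c) \<in> R" "(c, b) \<in> R"
      using RR by (metis relcompE)
    with assms show "p \<in> Id" by (metis IdI partial_bijection_unique)
  qed
qed (auto simp: subset_iff)

text \<open>The natural order of an inverse semigroup, here the right-hand side of the defining equation
  \<open>x = y \<cdot> d(x)\<close>, is inclusion of relations.\<close>

lemma partial_bijection_restrict_iff:
  assumes "partial_bijection R"
  shows "Q = Id_on (Domain Q) O R \<longleftrightarrow> Q \<subseteq> R"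
proof
  assume "Q \<subseteq> R"
  then show "Q = Id_on (Domain Q) O R"
    using assms by (auto dest: partial_bijection_right_unique)
qed auto

lemma Upper_pair:
  "\<lbrakk>x \<in> carrier L; y \<in> carrier L\<rbrakk>
    \<Longrightarrow> Upper L {x, y} = {u \<in> carrier L. x \<sqsubseteq>\<^bsub>L\<^esub> u \<and> y \<sqsubseteq>\<^bsub>L\<^esub> u}"
  and Lower_pair:
  "\<lbrakk>x \<in> carrier L; y \<in> carrier L\<rbrakk>
    \<Longrightarrow> Lower L {x, y} = {u \<in> carrier L. u \<sqsubseteq>\<^bsub>L\<^esub> x \<and> u \<sqsubseteq>\<^bsub>L\<^esub> y}"
  unfolding Upper_def Lower_def by blast+

text \<open>The bias operation \<open>x \<oslash> y\<close> on partial bijections: \<open>x\<close> is cut down on both sides to the points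
  that \<open>y\<close> does not touch.\<close>

definition rel_skew_diff :: "('a \<times> 'a) set \<Rightarrow> ('a \<times> 'a) set \<Rightarrow> ('a \<times> 'a) set" where
  "rel_skew_diff R Q = {(a, b) \<in> R. a \<notin> Domain Q \<and> b \<notin> Range Q}"

lemma partial_bijection_skew_diff:
  "partial_bijection R \<Longrightarrow> partial_bijection (rel_skew_diff R Q)"
  unfolding partial_bijection_def rel_skew_diff_def single_valued_def by blast

text \<open>A product \<open>x \<cdot> y\<close> applies \<open>y\<close> first, whereas \<open>O\<close> composes from left to right; hence the
  reversal in the clause for products.\<close>

primrec bias_rel :: "(nat \<Rightarrow> ('a \<times> 'a) set) \<Rightarrow> bias_term \<Rightarrow> ('a \<times> 'a) set" where
  "bias_rel V (BVar k) = V k"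
| "bias_rel V BZero = {}"
| "bias_rel V (BInv s) = (bias_rel V s)\<inverse>"
| "bias_rel V (BMul s t) = bias_rel V t O bias_rel V s"
| "bias_rel V (BDiff s t) = rel_skew_diff (bias_rel V s) (bias_rel V t)"
| "bias_rel V (BAdd s t) = rel_skew_diff (bias_rel V s) (bias_rel V t) \<union> bias_rel V t"

section \<open>Semigroups of partial bijections\<close>

text \<open>The closure conditions speak about the image of \<open>\<rho>\<close>, not about operations of \<open>S\<close>, since
  inverse, difference and orthogonal join are defined in \<open>S\<close> by descriptions that make sense only
  once such elements are known to exist. Together with closure under composition they suffice to make
  \<open>S\<close> a Boolean inverse semigroup.\<close>

locale partial_bijection_representation =
  fixes S :: "'a semigroup0" and \<rho> :: "'a \<Rightarrow> ('b \<times> 'b) set"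
  assumes inj_rep: "inj_on \<rho> (carrier S)"
    and partial_bijection_rep: "x \<in> carrier S \<Longrightarrow> partial_bijection (\<rho> x)"
    and mult_closed: "\<lbrakk>x \<in> carrier S; y \<in> carrier S\<rbrakk> \<Longrightarrow> x \<cdot>\<^bsub>S\<^esub> y \<in> carrier S"
    and rep_mult: "\<lbrakk>x \<in> carrier S; y \<in> carrier S\<rbrakk> \<Longrightarrow> \<rho> (x \<cdot>\<^bsub>S\<^esub> y) = \<rho> y O \<rho> x"
    and zero_closed: "\<zero>\<^sub>s\<^bsub>S\<^esub> \<in> carrier S"
    and rep_zero: "\<rho> \<zero>\<^sub>s\<^bsub>S\<^esub> = {}"
    and converse_in_image: "R \<in> \<rho> ` carrier S \<Longrightarrow> R\<inverse> \<in> \<rho> ` carrier S"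
    and diff_in_image: "\<lbrakk>R \<in> \<rho> ` carrier S; Q \<in> \<rho> ` carrier S; R \<subseteq> Id; Q \<subseteq> Id\<rbrakk>
      \<Longrightarrow> R - Q \<in> \<rho> ` carrier S"
    and union_in_image: "\<lbrakk>R \<in> \<rho> ` carrier S; Q \<in> \<rho> ` carrier S;
        Domain R \<inter> Domain Q = {}; Range R \<inter> Range Q = {}\<rbrakk> \<Longrightarrow> R \<union> Q \<in> \<rho> ` carrier S"
begin

lemma rep_eq_iff: "\<lbrakk>x \<in> carrier S; y \<in> carrier S\<rbrakk> \<Longrightarrow> \<rho> x = \<rho> y \<longleftrightarrow> x = y"
  using inj_rep by (rule inj_on_eq_iff)

lemma is_sinv_iff:
  assumes "x \<in> carrier S" "y \<in> carrier S"
  shows "is_sinv S x y \<longleftrightarrow> \<rho> y = (\<rho> x)\<inverse>"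
proof -
  have "is_sinv S x y \<longleftrightarrow> \<rho> x O \<rho> y O \<rho> x = \<rho> x \<and> \<rho> y O \<rho> x O \<rho> y = \<rho> y"
    unfolding is_sinv_def using assms
    by (simp add: rep_eq_iff[symmetric] mult_closed rep_mult) metis
  also have "\<dots> \<longleftrightarrow> \<rho> y = (\<rho> x)\<inverse>"
    using partial_bijection_generalized_inverse[of "\<rho> x" "\<rho> y"] partial_bijection_rep[OF assms(1)]
      partial_bijection_rep[OF assms(2)] partial_bijection_regular[of "\<rho> x"]
      partial_bijection_regular[of "(\<rho> x)\<inverse>"] partial_bijection_converse[of "\<rho> x"]
    by (metis converse_converse)
  finally show ?thesis .
qed

lemma ex1_sinv: "x \<in> carrier S \<Longrightarrow> \<exists>!y. y \<in> carrier S \<and> is_sinv S x y"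
  using converse_in_image[of "\<rho> x"] by (auto simp: is_sinv_iff rep_eq_iff[symmetric])

lemma sinv_closed: "x \<in> carrier S \<Longrightarrow> sinv S x \<in> carrier S"
  and rep_sinv: "x \<in> carrier S \<Longrightarrow> \<rho> (sinv S x) = (\<rho> x)\<inverse>"
  using theI'[OF ex1_sinv[of x]] unfolding sinv_def[symmetric] by (auto simp: is_sinv_iff)

lemma dom_idp_closed: "x \<in> carrier S \<Longrightarrow> dom_idp S x \<in> carrier S"
  and rng_idp_closed: "x \<in> carrier S \<Longrightarrow> rng_idp S x \<in> carrier S"
  unfolding dom_idp_def rng_idp_def by (auto simp: mult_closed sinv_closed)

lemma rep_dom_idp: "x \<in> carrier S \<Longrightarrow> \<rho> (dom_idp S x) = Id_on (Domain (\<rho> x))"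
  unfolding dom_idp_def
  by (simp add: rep_mult sinv_closed rep_sinv partial_bijection_dom partial_bijection_rep)

lemma rep_rng_idp: "x \<in> carrier S \<Longrightarrow> \<rho> (rng_idp S x) = Id_on (Range (\<rho> x))"
  unfolding rng_idp_def
  by (simp add: rep_mult sinv_closed rep_sinv partial_bijection_ran partial_bijection_rep)

lemma natural_order_carrier [simp]: "carrier (natural_order S) = carrier S"
  and idp_order_carrier [simp]: "carrier (idp_order S) = Idp S"
  and idp_order_eq [simp]: "eq (idp_order S) = (=)"
  and idp_order_le: "le (idp_order S) = le (natural_order S)"
  by (simp_all add: natural_order_def idp_order_def)

lemma natural_le_iff:
  "\<lbrakk>x \<in> carrier S; y \<in> carrier S\<rbrakk> \<Longrightarrow> x \<sqsubseteq>\<^bsub>natural_order S\<^esub> y \<longleftrightarrow> \<rho> x \<subseteq> \<rho> y"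
  by (simp add: natural_order_def rep_eq_iff[symmetric] mult_closed dom_idp_closed rep_mult
      rep_dom_idp partial_bijection_restrict_iff partial_bijection_rep)

lemma Idp_iff: "e \<in> Idp S \<longleftrightarrow> e \<in> carrier S \<and> \<rho> e \<subseteq> Id"
  unfolding Idp_def using rep_eq_iff[of "e \<cdot>\<^bsub>S\<^esub> e" e]
    partial_bijection_idempotent_iff[OF partial_bijection_rep, of e]
  by (auto simp: mult_closed rep_mult)

lemma idp_le_iff:
  "\<lbrakk>x \<in> Idp S; y \<in> Idp S\<rbrakk> \<Longrightarrow> x \<sqsubseteq>\<^bsub>idp_order S\<^esub> y \<longleftrightarrow> \<rho> x \<subseteq> \<rho> y"
  by (simp add: idp_order_le natural_le_iff Idp_iff)

lemma orthogonal_iff: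
  assumes "x \<in> carrier S" "y \<in> carrier S"
  shows "orthogonal S x y \<longleftrightarrow>
    Domain (\<rho> x) \<inter> Domain (\<rho> y) = {} \<and> Range (\<rho> x) \<inter> Range (\<rho> y) = {}"
proof -
  have "orthogonal S x y \<longleftrightarrow> \<rho> y O (\<rho> x)\<inverse> = {} \<and> (\<rho> y)\<inverse> O \<rho> x = {}"
    unfolding orthogonal_def using assms
    by (simp add: rep_eq_iff[symmetric] mult_closed sinv_closed zero_closed rep_zero rep_mult
        rep_sinv)
  then show ?thesis by blast
qed

lemma least_natural_union:
  assumes "x \<in> carrier S" "y \<in> carrier S" "orthogonal S x y"
  shows "least (natural_order S) z (Upper (natural_order S) {x, y}) \<longleftrightarrow>
    z \<in> carrier S \<and> \<rho> z = \<rho> x \<union> \<rho> y"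
proof -
  have "\<rho> x \<union> \<rho> y \<in> \<rho> ` carrier S"
    using union_in_image assms by (simp add: orthogonal_iff)
  then obtain w where w: "w \<in> carrier S" "\<rho> w = \<rho> x \<union> \<rho> y" by auto
  have U: "Upper (natural_order S) {x, y} = {u \<in> carrier S. \<rho> x \<union> \<rho> y \<subseteq> \<rho> u}"
    using assms by (simp add: Upper_pair natural_le_iff cong: conj_cong)
  have "least (natural_order S) z (Upper (natural_order S) {x, y}) \<longleftrightarrow>
    z \<in> carrier S \<and> \<rho> x \<union> \<rho> y \<subseteq> \<rho> z \<and> (\<forall>u \<in> carrier S. \<rho> x \<union> \<rho> y \<subseteq> \<rho> u \<longrightarrow> \<rho> z \<subseteq> \<rho> u)"
    unfolding U least_def natural_order_carrier using natural_le_iff[of z] by blast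
  also have "\<dots> \<longleftrightarrow> z \<in> carrier S \<and> \<rho> z = \<rho> x \<union> \<rho> y"
    using w by (metis subset_antisym subset_refl)
  finally show ?thesis .
qed

lemma ojoin_closed_rep:
  assumes "x \<in> carrier S" "y \<in> carrier S" "orthogonal S x y"
  shows "ojoin S x y \<in> carrier S \<and> \<rho> (ojoin S x y) = \<rho> x \<union> \<rho> y"
proof -
  obtain w where "w \<in> carrier S" "\<rho> w = \<rho> x \<union> \<rho> y"
    using union_in_image[of "\<rho> x" "\<rho> y"] assms by (auto simp: orthogonal_iff)
  then have "\<exists>z. z \<in> carrier S \<and> \<rho> z = \<rho> x \<union> \<rho> y" by blast
  then show ?thesis
    unfolding ojoin_def join_def Lattice.sup_def least_natural_union[OF assms] by (rule someI_ex)
qed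

text \<open>Only orthogonal unions are assumed to exist. Idempotents have all unions nevertheless, because
  \<open>e \<union> f\<close> is the orthogonal union of \<open>e - f\<close> and \<open>f\<close>.\<close>

lemma idp_union_diff:
  assumes "e \<in> Idp S" "f \<in> Idp S"
  shows "\<rho> e - \<rho> f \<in> \<rho> ` carrier S" "\<rho> e \<union> \<rho> f \<in> \<rho> ` carrier S"
proof -
  show d: "\<rho> e - \<rho> f \<in> \<rho> ` carrier S"
    using assms diff_in_image by (simp add: Idp_iff)
  have "(\<rho> e - \<rho> f) \<union> \<rho> f \<in> \<rho> ` carrier S"
    using assms by (intro union_in_image d) (auto simp: Idp_iff subset_iff)
  then show "\<rho> e \<union> \<rho> f \<in> \<rho> ` carrier S" by simp
qed

lemma least_idp_union:
  assumes "e \<in> Idp S" "f \<in> Idp S"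
  shows "least (idp_order S) z (Upper (idp_order S) {e, f}) \<longleftrightarrow>
    z \<in> carrier S \<and> \<rho> z = \<rho> e \<union> \<rho> f"
proof -
  obtain w where w: "w \<in> carrier S" "\<rho> w = \<rho> e \<union> \<rho> f" using idp_union_diff(2)[OF assms] by auto
  then have wI: "w \<in> Idp S" using assms by (auto simp: Idp_iff)
  have U: "Upper (idp_order S) {e, f} = {u \<in> Idp S. \<rho> e \<union> \<rho> f \<subseteq> \<rho> u}"
    using assms by (simp add: Upper_pair idp_le_iff cong: conj_cong)
  have "least (idp_order S) z (Upper (idp_order S) {e, f}) \<longleftrightarrow>
    z \<in> Idp S \<and> \<rho> e \<union> \<rho> f \<subseteq> \<rho> z \<and> (\<forall>u \<in> Idp S. \<rho> e \<union> \<rho> f \<subseteq> \<rho> u \<longrightarrow> \<rho> z \<subseteq> \<rho> u)"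
    unfolding U least_def idp_order_carrier using idp_le_iff[of z] by blast
  also have "\<dots> \<longleftrightarrow> z \<in> carrier S \<and> \<rho> z = \<rho> e \<union> \<rho> f"
    using w wI by (metis subset_antisym subset_refl Idp_iff)
  finally show ?thesis .
qed

lemma greatest_idp_inter:
  assumes "e \<in> Idp S" "f \<in> Idp S"
  shows "greatest (idp_order S) z (Lower (idp_order S) {e, f}) \<longleftrightarrow>
    z \<in> carrier S \<and> \<rho> z = \<rho> e \<inter> \<rho> f"
proof -
  have "\<rho> f O \<rho> e = \<rho> e \<inter> \<rho> f" using assms by (auto simp: Idp_iff subset_iff)
  then obtain w where w: "w \<in> carrier S" "\<rho> w = \<rho> e \<inter> \<rho> f"
    using assms rep_mult[of e f] mult_closed[of e f] by (auto simp: Idp_iff)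
  then have wI: "w \<in> Idp S" using assms by (auto simp: Idp_iff)
  have U: "Lower (idp_order S) {e, f} = {u \<in> Idp S. \<rho> u \<subseteq> \<rho> e \<inter> \<rho> f}"
    using assms by (simp add: Lower_pair idp_le_iff cong: conj_cong)
  have "greatest (idp_order S) z (Lower (idp_order S) {e, f}) \<longleftrightarrow>
    z \<in> Idp S \<and> \<rho> z \<subseteq> \<rho> e \<inter> \<rho> f \<and> (\<forall>u \<in> Idp S. \<rho> u \<subseteq> \<rho> e \<inter> \<rho> f \<longrightarrow> \<rho> u \<subseteq> \<rho> z)"
    unfolding U greatest_def idp_order_carrier using idp_le_iff[of _ z] by blast
  also have "\<dots> \<longleftrightarrow> z \<in> carrier S \<and> \<rho> z = \<rho> e \<inter> \<rho> f"
    using w wI by (metis subset_antisym subset_refl Idp_iff)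
  finally show ?thesis .
qed

lemma least_idp_zero: "least (idp_order S) z (Idp S) \<longleftrightarrow> z \<in> carrier S \<and> \<rho> z = {}"
proof -
  have 0: "\<zero>\<^sub>s\<^bsub>S\<^esub> \<in> Idp S" by (simp add: Idp_iff zero_closed rep_zero)
  have "least (idp_order S) z (Idp S) \<longleftrightarrow> z \<in> Idp S \<and> (\<forall>u \<in> Idp S. \<rho> z \<subseteq> \<rho> u)"
    unfolding least_def idp_order_carrier using idp_le_iff[of z] by blast
  also have "\<dots> \<longleftrightarrow> z \<in> carrier S \<and> \<rho> z = {}"
    using 0 rep_zero by (metis Idp_iff empty_subsetI subset_empty)
  finally show ?thesis .
qed

lemma idp_join:
  assumes "e \<in> Idp S" "f \<in> Idp S"
  shows "e \<squnion>\<^bsub>idp_order S\<^esub> f \<in> Idp S \<and> \<rho> (e \<squnion>\<^bsub>idp_order S\<^esub> f) = \<rho> e \<union> \<rho> f"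
proof -
  have "\<exists>z. z \<in> carrier S \<and> \<rho> z = \<rho> e \<union> \<rho> f" using idp_union_diff(2)[OF assms] by auto
  from someI_ex[OF this] show ?thesis
    unfolding join_def Lattice.sup_def least_idp_union[OF assms]
    using assms by (auto simp: Idp_iff)
qed

lemma idp_meet:
  assumes "e \<in> Idp S" "f \<in> Idp S"
  shows "e \<sqinter>\<^bsub>idp_order S\<^esub> f \<in> Idp S \<and> \<rho> (e \<sqinter>\<^bsub>idp_order S\<^esub> f) = \<rho> e \<inter> \<rho> f"
proof -
  have "\<rho> f O \<rho> e = \<rho> e \<inter> \<rho> f" using assms by (auto simp: Idp_iff subset_iff)
  then have "\<exists>z. z \<in> carrier S \<and> \<rho> z = \<rho> e \<inter> \<rho> f"
    using assms rep_mult[of e f] mult_closed[of e f] by (auto simp: Idp_iff)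
  from someI_ex[OF this] show ?thesis
    unfolding meet_def Lattice.inf_def greatest_idp_inter[OF assms]
    using assms by (auto simp: Idp_iff)
qed

lemma idp_bottom: "\<bottom>\<^bsub>idp_order S\<^esub> \<in> carrier S \<and> \<rho> \<bottom>\<^bsub>idp_order S\<^esub> = {}"
proof -
  have "\<exists>z. z \<in> carrier S \<and> \<rho> z = {}" using zero_closed rep_zero by blast
  from someI_ex[OF this] show ?thesis unfolding bottom_def idp_order_carrier least_idp_zero .
qed

lemma is_difference_iff:
  assumes "e \<in> Idp S" "f \<in> Idp S"
  shows "is_difference (idp_order S) e f g \<longleftrightarrow> g \<in> carrier S \<and> \<rho> g = \<rho> e - \<rho> f"
proof -
  have "is_difference (idp_order S) e f g \<longleftrightarrow>
    g \<in> Idp S \<and> \<rho> e \<inter> \<rho> f \<union> \<rho> g = \<rho> e \<and> \<rho> f \<inter> \<rho> g = {}"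
    unfolding is_difference_def idp_order_carrier
    using assms idp_join idp_meet idp_bottom by (metis rep_eq_iff Idp_iff)
  also have "\<dots> \<longleftrightarrow> g \<in> carrier S \<and> \<rho> g = \<rho> e - \<rho> f"
    using assms by (auto simp: Idp_iff)
  finally show ?thesis .
qed

lemma idp_diff_closed_rep:
  assumes "e \<in> Idp S" "f \<in> Idp S"
  shows "idp_diff S e f \<in> carrier S \<and> \<rho> (idp_diff S e f) = \<rho> e - \<rho> f"
proof -
  have "\<exists>!g. is_difference (idp_order S) e f g"
    using idp_union_diff(1)[OF assms] unfolding is_difference_iff[OF assms]
    by (auto simp: rep_eq_iff[symmetric])
  from theI'[OF this] show ?thesis
    unfolding idp_diff_def is_difference_iff[OF assms] .
qed

lemma skew_diff_closed_rep:
  assumes x: "x \<in> carrier S" and y: "y \<in> carrier S"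
  shows "skew_diff S x y \<in> carrier S \<and> \<rho> (skew_diff S x y) = rel_skew_diff (\<rho> x) (\<rho> y)"
proof -
  have I: "dom_idp S z \<in> Idp S" "rng_idp S z \<in> Idp S" if "z \<in> carrier S" for z
    using that by (auto simp: Idp_iff dom_idp_closed rng_idp_closed rep_dom_idp rep_rng_idp)
  note r = idp_diff_closed_rep[OF I(2)[OF x] I(2)[OF y]]
    and d = idp_diff_closed_rep[OF I(1)[OF x] I(1)[OF y]]
  show ?thesis
    using x y unfolding skew_diff_def rel_skew_diff_def
    by (auto simp: mult_closed rep_mult r d rep_dom_idp rep_rng_idp)
qed

lemma skew_add_closed_rep:
  assumes x: "x \<in> carrier S" and y: "y \<in> carrier S"
  shows "skew_add S x y \<in> carrier S \<and>
    \<rho> (skew_add S x y) = rel_skew_diff (\<rho> x) (\<rho> y) \<union> \<rho> y"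
proof -
  note d = skew_diff_closed_rep[OF assms]
  then have "orthogonal S (skew_diff S x y) y"
    using y by (auto simp: orthogonal_iff rel_skew_diff_def)
  with d y show ?thesis unfolding skew_add_def by (simp add: ojoin_closed_rep)
qed

text \<open>Every operation of a bias is now known on relations, so evaluation of terms commutes with the
  representation.\<close>

theorem bias_eval_closed_rep:
  assumes "range v \<subseteq> carrier S"
  shows "bias_eval S v s \<in> carrier S \<and> \<rho> (bias_eval S v s) = bias_rel (\<lambda>k. \<rho> (v k)) s"
proof (induction s)
  case (BVar k) show ?case using assms by auto
qed (simp_all add: zero_closed rep_zero sinv_closed rep_sinv mult_closed rep_mult
    skew_diff_closed_rep skew_add_closed_rep)

theorem boolean_inverse_semigroup: "boolean_inverse_semigroup S"
proof -
  interpret semigroup_with_zero S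
    by unfold_locales
      (auto simp: mult_closed zero_closed rep_eq_iff[symmetric] rep_mult rep_zero O_assoc)
  interpret inverse_semigroup_with_zero S
    by unfold_locales (rule ex1_sinv)
  have "generalized_boolean_algebra (idp_order S)"
  proof unfold_locales
    fix x y assume "x \<in> carrier (idp_order S)" "y \<in> carrier (idp_order S)"
    then have xy: "x \<in> Idp S" "y \<in> Idp S" by simp_all
    show "\<exists>s. least (idp_order S) s (Upper (idp_order S) {x, y})"
      unfolding least_idp_union[OF xy] using idp_union_diff(2)[OF xy] by auto
    show "\<exists>s. greatest (idp_order S) s (Lower (idp_order S) {x, y})"
      unfolding greatest_idp_inter[OF xy] using idp_meet[OF xy] by (auto simp: Idp_iff)
    show "\<exists>z. is_difference (idp_order S) x y z"
      unfolding is_difference_iff[OF xy] using idp_union_diff(1)[OF xy] by auto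
    fix z assume "z \<in> carrier (idp_order S)"
    then have z: "z \<in> Idp S" by simp
    have "\<rho> (x \<sqinter>\<^bsub>idp_order S\<^esub> (y \<squnion>\<^bsub>idp_order S\<^esub> z)) =
      \<rho> ((x \<sqinter>\<^bsub>idp_order S\<^esub> y) \<squnion>\<^bsub>idp_order S\<^esub> (x \<sqinter>\<^bsub>idp_order S\<^esub> z))"
      using xy z by (simp add: idp_join idp_meet Int_Un_distrib)
    then show "x \<sqinter>\<^bsub>idp_order S\<^esub> (y \<squnion>\<^bsub>idp_order S\<^esub> z) =
      (x \<sqinter>\<^bsub>idp_order S\<^esub> y) \<squnion>\<^bsub>idp_order S\<^esub> (x \<sqinter>\<^bsub>idp_order S\<^esub> z)"
      using xy z idp_join idp_meet by (metis rep_eq_iff Idp_iff)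
  next
    show "\<exists>x. least (idp_order S) x (carrier (idp_order S))"
      using idp_bottom by (auto simp: least_idp_zero)
  qed (auto simp: idp_le_iff rep_eq_iff Idp_iff)
  then show ?thesis
  proof (intro boolean_inverse_semigroup.intro boolean_inverse_semigroup_axioms.intro
      inverse_semigroup_with_zero_axioms)
    fix x y assume "x \<in> carrier S" "y \<in> carrier S" "orthogonal S x y"
    then show "\<exists>z. least (natural_order S) z (Upper (natural_order S) {x, y})"
      using ojoin_closed_rep least_natural_union by blast
  qed
qed

text \<open>Since \<open>\<rho>\<close> is injective, identities can be tested on the represented relations; the original
  semigroup enters only through the set of relations that it represents.\<close>

lemma bias_satisfies_iff:
  "bias_satisfies S \<Sigma> \<longleftrightarrow> (\<forall>(s, t) \<in> \<Sigma>. \<forall>V. range V \<subseteq> \<rho> ` carrier S \<longrightarrow> bias_rel V s = bias_rel V t)"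
proof -
  have "(\<forall>v. range v \<subseteq> carrier S \<longrightarrow> bias_eval S v s = bias_eval S v t) \<longleftrightarrow>
    (\<forall>V. range V \<subseteq> \<rho> ` carrier S \<longrightarrow> bias_rel V s = bias_rel V t)" (is "?L \<longleftrightarrow> ?R") for s t
  proof
    assume L: ?L
    show ?R
    proof (intro allI impI)
      fix V :: "nat \<Rightarrow> ('b \<times> 'b) set" assume "range V \<subseteq> \<rho> ` carrier S"
      then have "\<forall>k. \<exists>x \<in> carrier S. V k = \<rho> x" by auto
      then obtain v where v: "\<forall>k. v k \<in> carrier S \<and> V k = \<rho> (v k)" by metis
      then have "range v \<subseteq> carrier S" "V = (\<lambda>k. \<rho> (v k))" by auto
      with L show "bias_rel V s = bias_rel V t" by (metis bias_eval_closed_rep)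
    qed
  next
    assume R: ?R
    show ?L
    proof (intro allI impI)
      fix v :: "nat \<Rightarrow> 'a" assume v: "range v \<subseteq> carrier S"
      then have "range (\<lambda>k. \<rho> (v k)) \<subseteq> \<rho> ` carrier S" by auto
      with R have "bias_rel (\<lambda>k. \<rho> (v k)) s = bias_rel (\<lambda>k. \<rho> (v k)) t" by blast
      with v show "bias_eval S v s = bias_eval S v t"
        by (metis bias_eval_closed_rep rep_eq_iff)
    qed
  qed
  then show ?thesis unfolding bias_satisfies_def by auto
qed

end

section \<open>Rook matrices over a group with zero as equivariant partial bijections\<close>

lemma group0_carrier: "x \<in> carrier (group0 G) \<longleftrightarrow> (\<forall>g. x = Some g \<longrightarrow> g \<in> carrier G)"
  by (cases x) (auto simp: group0_def)

lemma group0_zero [simp]: "\<zero>\<^sub>s\<^bsub>group0 G\<^esub> = None"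
  by (simp add: group0_def)

lemma group0_mult [simp]:
  "None \<cdot>\<^bsub>group0 G\<^esub> y = None" "x \<cdot>\<^bsub>group0 G\<^esub> None = None"
  "Some g \<cdot>\<^bsub>group0 G\<^esub> Some h = Some (g \<otimes>\<^bsub>G\<^esub> h)"
  by (simp_all add: group0_def split: option.splits)

lemma group0_mult_eq_Some_iff:
  "x \<cdot>\<^bsub>group0 G\<^esub> y = Some c \<longleftrightarrow> (\<exists>g h. x = Some g \<and> y = Some h \<and> c = g \<otimes>\<^bsub>G\<^esub> h)"
  by (cases x; cases y) auto

lemma group0_mult_eq_None_iff: "x \<cdot>\<^bsub>group0 G\<^esub> y = None \<longleftrightarrow> x = None \<or> y = None"
  by (cases x; cases y) auto

text \<open>Rook matrices, wreath products and varieties take a \<open>monoid\<close> record without further fields,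
  whereas the locale \<open>group\<close> allows record extensions.\<close>

locale plain_group = group G for G :: "'g monoid" (structure)
begin

lemma group0_is_sinv_iff:
  assumes "x \<in> carrier (group0 G)" "y \<in> carrier (group0 G)"
  shows "is_sinv (group0 G) x y \<longleftrightarrow> y = map_option (m_inv G) x"
proof (cases x; cases y)
  fix g h assume xy: "x = Some g" "y = Some h"
  with assms have c: "g \<in> carrier G" "h \<in> carrier G" by (auto simp: group0_carrier)
  have "h = inv g" if "g = g \<otimes> h \<otimes> g"
  proof -
    from that c have "(g \<otimes> h) \<otimes> g = \<one> \<otimes> g" by simp
    with c have "g \<otimes> h = \<one>" by (metis m_closed one_closed right_cancel)
    with c show ?thesis by (metis inv_equality inv_inv)
  qed
  with xy c show ?thesis by (auto simp: is_sinv_def)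
qed (auto simp: is_sinv_def)

lemma group0_sinv:
  assumes "x \<in> carrier (group0 G)"
  shows "sinv (group0 G) x = map_option (m_inv G) x"
  unfolding sinv_def
proof (rule the_equality)
  have "map_option (m_inv G) x \<in> carrier (group0 G)"
    using assms by (auto simp: group0_carrier)
  with assms show "map_option (m_inv G) x \<in> carrier (group0 G) \<and>
      is_sinv (group0 G) x (map_option (m_inv G) x)"
    by (simp add: group0_is_sinv_iff)
qed (use assms group0_is_sinv_iff in blast)

lemma group0_natural_le_iff:
  assumes "x \<in> carrier (group0 G)" "y \<in> carrier (group0 G)"
  shows "x \<sqsubseteq>\<^bsub>natural_order (group0 G)\<^esub> y \<longleftrightarrow> x = None \<or> x = y"
  using assms
  by (cases x; cases y) (auto simp: natural_order_def dom_idp_def group0_sinv group0_carrier)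

text \<open>The sums that occur in a product of rook matrices have at most one nonzero summand, which is
  then their value.\<close>

lemma group0_ojoin_family:
  assumes c: "c \<in> carrier (group0 G)" and f: "f ` K \<subseteq> {None, c}" and cK: "c \<in> insert None (f ` K)"
  shows "ojoin_family (group0 G) K f = c"
proof -
  let ?L = "natural_order (group0 G)"
  have N: "None \<in> carrier (group0 G)" by (simp add: group0_carrier)
  have [simp]: "carrier ?L = carrier (group0 G)" by (simp add: natural_order_def)
  have U: "Upper ?L (f ` K) = {u \<in> carrier (group0 G). c = None \<or> c = u}"
    unfolding Upper_def using f cK c N group0_natural_le_iff by (fastforce simp: image_subset_iff)
  have "least ?L x (Upper ?L (f ` K)) \<longleftrightarrow> x = c" for x
    unfolding least_def U using c N group0_natural_le_iff by auto
  then show ?thesis unfolding ojoin_family_def supr_def Lattice.sup_def by simp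
qed

lemma rook_matrix_group0_iff:
  "rook_matrix n (group0 G) x \<longleftrightarrow> x \<in> {1..n} \<times> {1..n} \<rightarrow>\<^sub>E carrier (group0 G) \<and>
    (\<forall>i \<in> {1..n}. \<forall>j \<in> {1..n}. \<forall>k \<in> {1..n}.
      j \<noteq> k \<longrightarrow> (x (i, j) = None \<or> x (i, k) = None) \<and> (x (j, i) = None \<or> x (k, i) = None))"
proof (cases "x \<in> {1..n} \<times> {1..n} \<rightarrow>\<^sub>E carrier (group0 G)")
  case True
  then have "sinv (group0 G) (x (i, j)) = map_option (m_inv G) (x (i, j))"
    if "i \<in> {1..n}" "j \<in> {1..n}" for i j
    using that by (intro group0_sinv) auto
  with True show ?thesis
    unfolding rook_matrix_def by (simp add: group0_mult_eq_None_iff)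
qed (simp add: rook_matrix_def)

end

text \<open>Column \<open>j\<close> of the matrix tells where the points \<open>(j, u)\<close> go. Labels multiply on the left, so the action
  commutes with right multiplication by \<open>G\<close>.\<close>

definition rook_rel :: "'g monoid \<Rightarrow> nat \<Rightarrow> (nat \<times> nat \<Rightarrow> 'g option) \<Rightarrow>
    ((nat \<times> 'g) \<times> (nat \<times> 'g)) set" where
  "rook_rel G n x = {((j, u), (i, h \<otimes>\<^bsub>G\<^esub> u)) | i j h u.
    i \<in> {1..n} \<and> j \<in> {1..n} \<and> u \<in> carrier G \<and> x (i, j) = Some h}"

definition equivariant :: "'g monoid \<Rightarrow> ((nat \<times> 'g) \<times> (nat \<times> 'g)) set \<Rightarrow> bool" where
  "equivariant G R \<longleftrightarrow> (\<forall>j u i v. \<forall>w \<in> carrier G.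
    ((j, u), (i, v)) \<in> R \<longrightarrow> ((j, u \<otimes>\<^bsub>G\<^esub> w), (i, v \<otimes>\<^bsub>G\<^esub> w)) \<in> R)"

definition equivariant_bijections ::
    "'g monoid \<Rightarrow> nat set \<Rightarrow> ((nat \<times> 'g) \<times> (nat \<times> 'g)) set set" where
  "equivariant_bijections G J = {R. partial_bijection R \<and>
    R \<subseteq> (J \<times> carrier G) \<times> (J \<times> carrier G) \<and> equivariant G R}"

lemma equivariantD:
  "\<lbrakk>equivariant G R; ((j, u), (i, v)) \<in> R; w \<in> carrier G\<rbrakk>
    \<Longrightarrow> ((j, u \<otimes>\<^bsub>G\<^esub> w), (i, v \<otimes>\<^bsub>G\<^esub> w)) \<in> R"
  unfolding equivariant_def by blast

lemma equivariant_bijectionsD: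
  assumes "R \<in> equivariant_bijections G J"
  shows "partial_bijection R" "equivariant G R" "R \<subseteq> (J \<times> carrier G) \<times> (J \<times> carrier G)"
  using assms by (auto simp: equivariant_bijections_def)

lemma rook_relE:
  assumes "p \<in> rook_rel G n x"
  obtains i j h u where "p = ((j, u), (i, h \<otimes>\<^bsub>G\<^esub> u))" "i \<in> {1..n}" "j \<in> {1..n}" "u \<in> carrier G"
    "x (i, j) = Some h"
  using assms unfolding rook_rel_def by blast

lemma rook_rel_iff:
  "((j, u), (i, v)) \<in> rook_rel G n x \<longleftrightarrow> i \<in> {1..n} \<and> j \<in> {1..n} \<and> u \<in> carrier G \<and>
    (\<exists>h. x (i, j) = Some h \<and> v = h \<otimes>\<^bsub>G\<^esub> u)"
  unfolding rook_rel_def by blast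

context plain_group
begin

lemma rook_carrier_iff: "x \<in> carrier (rook_matrices n (group0 G)) \<longleftrightarrow> rook_matrix n (group0 G) x"
  by (simp add: rook_matrices_def)

lemma rook_entry:
  assumes "x \<in> carrier (rook_matrices n (group0 G))" "i \<in> {1..n}" "j \<in> {1..n}" "x (i, j) = Some h"
  shows "h \<in> carrier G"
proof -
  have "x (i, j) \<in> carrier (group0 G)"
    using assms by (intro PiE_mem[of x "{1..n} \<times> {1..n}"])
      (simp_all add: rook_carrier_iff rook_matrix_group0_iff)
  with assms(4) show ?thesis by (simp add: group0_carrier)
qed

lemma rook_row_unique:
  "\<lbrakk>x \<in> carrier (rook_matrices n (group0 G)); x (i, j) = Some g; x (i, k) = Some h;
    i \<in> {1..n}; j \<in> {1..n}; k \<in> {1..n}\<rbrakk> \<Longrightarrow> j = k"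
  unfolding rook_carrier_iff rook_matrix_group0_iff by (metis option.distinct(1))

lemma rook_col_unique:
  "\<lbrakk>x \<in> carrier (rook_matrices n (group0 G)); x (j, i) = Some g; x (k, i) = Some h;
    i \<in> {1..n}; j \<in> {1..n}; k \<in> {1..n}\<rbrakk> \<Longrightarrow> j = k"
  unfolding rook_carrier_iff rook_matrix_group0_iff by (metis option.distinct(1))

lemma rook_rel_in:
  assumes x: "x \<in> carrier (rook_matrices n (group0 G))"
  shows "rook_rel G n x \<in> equivariant_bijections G {1..n}"
proof -
  note e = rook_entry[OF x]
  have "partial_bijection (rook_rel G n x)"
  proof (rule partial_bijectionI)
    fix a b c assume ab: "(a, b) \<in> rook_rel G n x" and ac: "(a, c) \<in> rook_rel G n x"
    then obtain i j h u where ab': "a = (j, u)" "b = (i, h \<otimes> u)" "i \<in> {1..n}" "j \<in> {1..n}"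
      "x (i, j) = Some h" by (auto elim!: rook_relE)
    from ac ab' obtain i' h' where "c = (i', h' \<otimes> u)" "i' \<in> {1..n}" "x (i', j) = Some h'"
      by (auto elim!: rook_relE)
    with ab' rook_col_unique[OF x] show "b = c" by (metis option.inject)
  next
    fix a b c assume ac: "(a, c) \<in> rook_rel G n x" and bc: "(b, c) \<in> rook_rel G n x"
    from ac obtain i j h u where ac': "a = (j, u)" "c = (i, h \<otimes> u)" "i \<in> {1..n}" "j \<in> {1..n}"
      "x (i, j) = Some h" "u \<in> carrier G" by (auto elim!: rook_relE)
    from bc obtain i' j' h' u' where "(b, c) = ((j', u'), (i', h' \<otimes> u'))" "j' \<in> {1..n}"
      "x (i', j') = Some h'" "u' \<in> carrier G" by (rule rook_relE)
    with ac' have bc': "b = (j', u')" "h \<otimes> u = h' \<otimes> u'" "j' \<in> {1..n}"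
      "x (i, j') = Some h'" "u' \<in> carrier G" by auto
    with ac' have "j' = j" using rook_row_unique[OF x] by metis
    moreover from this ac' bc' have "h' = h" by simp
    ultimately show "a = b" using ac' bc' e by auto
  qed
  moreover have "equivariant G (rook_rel G n x)"
    unfolding equivariant_def using e by (auto simp: rook_rel_iff m_assoc)
  moreover have "rook_rel G n x \<subseteq> ({1..n} \<times> carrier G) \<times> ({1..n} \<times> carrier G)"
    using e by (auto elim!: rook_relE)
  ultimately show ?thesis by (simp add: equivariant_bijections_def)
qed

lemma rook_rel_one_iff:
  assumes "x \<in> carrier (rook_matrices n (group0 G))"
  shows "((j, \<one>), (i, h)) \<in> rook_rel G n x \<longleftrightarrow> i \<in> {1..n} \<and> j \<in> {1..n} \<and> x (i, j) = Some h"
  using rook_entry[OF assms] by (auto simp: rook_rel_iff)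

lemma inj_rook_rel: "inj_on (rook_rel G n) (carrier (rook_matrices n (group0 G)))"
proof (rule inj_onI)
  fix x y assume x: "x \<in> carrier (rook_matrices n (group0 G))"
    and y: "y \<in> carrier (rook_matrices n (group0 G))" and eq: "rook_rel G n x = rook_rel G n y"
  have "x p = y p" if p: "p \<in> {1..n} \<times> {1..n}" for p
  proof -
    obtain i j where ij: "p = (i, j)" "i \<in> {1..n}" "j \<in> {1..n}" using p by blast
    then have "x p = Some h \<longleftrightarrow> y p = Some h" for h
      using rook_rel_one_iff[OF x, of j i h] rook_rel_one_iff[OF y, of j i h] eq by simp
    then show ?thesis by (metis option.exhaust)
  qed
  moreover have "x \<in> extensional ({1..n} \<times> {1..n})" "y \<in> extensional ({1..n} \<times> {1..n})"
    using x y by (auto simp: rook_carrier_iff rook_matrix_group0_iff PiE_def)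
  ultimately show "x = y" by (intro extensionalityI)
qed

text \<open>An equivariant relation is determined by its pairs that start at a neutral label; these pairs
  are the entries of the corresponding matrix.\<close>

lemma equivariant_bijection_translate:
  assumes R: "R \<in> equivariant_bijections G J" and u: "u \<in> carrier G"
  shows "((j, u), (i, v)) \<in> R \<longleftrightarrow> v \<in> carrier G \<and> ((j, \<one>), (i, v \<otimes> inv u)) \<in> R"
proof
  assume a: "((j, u), (i, v)) \<in> R"
  then have v: "v \<in> carrier G" using R by (auto simp: equivariant_bijections_def)
  from equivariantD[OF equivariant_bijectionsD(2)[OF R] a, of "inv u"]
  show "v \<in> carrier G \<and> ((j, \<one>), (i, v \<otimes> inv u)) \<in> R" using u v by simp
next
  assume a: "v \<in> carrier G \<and> ((j, \<one>), (i, v \<otimes> inv u)) \<in> R"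
  from equivariantD[OF equivariant_bijectionsD(2)[OF R] conjunct2[OF a] u]
  show "((j, u), (i, v)) \<in> R" using u a by (simp add: m_assoc)
qed

text \<open>The matrix is read off from the images of the points \<open>(j, \<one>)\<close>. Two entries in one row would
  give, after translation, two preimages of one point.\<close>

lemma rook_rel_surj:
  assumes R: "R \<in> equivariant_bijections G {1..n}"
  shows "R \<in> rook_rel G n ` carrier (rook_matrices n (group0 G))"
proof -
  note pb = equivariant_bijectionsD(1)[OF R] and sub = equivariant_bijectionsD(3)[OF R]
  define x where "x = (\<lambda>p \<in> {1..n} \<times> {1..n}. case p of (i, j) \<Rightarrow>
    if \<exists>h. ((j, \<one>), (i, h)) \<in> R then Some (THE h. ((j, \<one>), (i, h)) \<in> R) else None)"
  have x: "x (i, j) = Some h \<longleftrightarrow> ((j, \<one>), (i, h)) \<in> R"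
    if "i \<in> {1..n}" "j \<in> {1..n}" for i j h
  proof -
    have "(THE h. ((j, \<one>), (i, h)) \<in> R) = h" if "((j, \<one>), (i, h)) \<in> R" for h
      using that partial_bijection_right_unique[OF pb] by (intro the_equality) blast+
    then show ?thesis using that by (auto simp: x_def)
  qed
  have xc: "x \<in> carrier (rook_matrices n (group0 G))"
    unfolding rook_carrier_iff rook_matrix_group0_iff
  proof (intro conjI ballI impI)
    show "x \<in> {1..n} \<times> {1..n} \<rightarrow>\<^sub>E carrier (group0 G)"
    proof (rule PiE_I)
      fix p assume "p \<in> {1..n} \<times> {1..n}"
      then obtain i j where ij: "p = (i, j)" "i \<in> {1..n}" "j \<in> {1..n}" by blast
      show "x p \<in> carrier (group0 G)"
        using x[OF ij(2,3)] sub by (auto simp: ij(1) group0_carrier)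
    qed (simp add: x_def)
  next
    fix i j k assume ijk: "i \<in> {1..n}" "j \<in> {1..n}" "k \<in> {1..n}"
      and "j \<noteq> k"
    show "x (i, j) = None \<or> x (i, k) = None"
    proof (rule ccontr)
      assume "\<not> ?thesis"
      with ijk obtain g h where gh: "((j, \<one>), (i, g)) \<in> R" "((k, \<one>), (i, h)) \<in> R"
        using x by (metis not_None_eq)
      then have c: "g \<in> carrier G" "h \<in> carrier G" using sub by auto
      have "((k, inv h \<otimes> g), (i, g)) \<in> R"
        using gh c by (subst equivariant_bijection_translate[OF R])
          (simp_all add: inv_mult_group m_assoc[symmetric])
      then show False using \<open>j \<noteq> k\<close> gh partial_bijection_left_unique[OF pb] by blast
    qed
    show "x (j, i) = None \<or> x (k, i) = None"
    proof (rule ccontr)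
      assume "\<not> ?thesis"
      with ijk obtain g h where gh: "((i, \<one>), (j, g)) \<in> R" "((i, \<one>), (k, h)) \<in> R"
        using x by (metis not_None_eq)
      then show False using \<open>j \<noteq> k\<close> partial_bijection_right_unique[OF pb] by blast
    qed
  qed
  have "((j, u), (i, v)) \<in> R \<longleftrightarrow> ((j, u), (i, v)) \<in> rook_rel G n x" for j u i v
  proof
    assume a: "((j, u), (i, v)) \<in> R"
    then have c: "i \<in> {1..n}" "j \<in> {1..n}" "u \<in> carrier G" "v \<in> carrier G" using sub by auto
    with a have "((j, \<one>), (i, v \<otimes> inv u)) \<in> R" using equivariant_bijection_translate[OF R] by blast
    with c show "((j, u), (i, v)) \<in> rook_rel G n x"
      by (auto simp: rook_rel_iff x m_assoc)
  next
    assume "((j, u), (i, v)) \<in> rook_rel G n x"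
    then obtain h where h: "i \<in> {1..n}" "j \<in> {1..n}" "u \<in> carrier G" "x (i, j) = Some h"
      "v = h \<otimes> u" by (auto simp: rook_rel_iff)
    with rook_entry[OF xc] have "h \<in> carrier G" by blast
    with h x show "((j, u), (i, v)) \<in> R"
      by (subst equivariant_bijection_translate[OF R]) (simp_all add: m_assoc)
  qed
  then have "R = rook_rel G n x" by (auto simp: set_eq_iff)
  with xc show ?thesis by blast
qed

lemma rook_rel_image:
  "rook_rel G n ` carrier (rook_matrices n (group0 G)) = equivariant_bijections G {1..n}"
  using rook_rel_in rook_rel_surj by blast

lemma rook_mult_entry:
  assumes x: "x \<in> carrier (rook_matrices n (group0 G))"
    and y: "y \<in> carrier (rook_matrices n (group0 G))"
    and ij: "i \<in> {1..n}" "j \<in> {1..n}"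
  shows "(x \<cdot>\<^bsub>rook_matrices n (group0 G)\<^esub> y) (i, j) = Some h \<longleftrightarrow>
    (\<exists>k \<in> {1..n}. x (i, k) \<cdot>\<^bsub>group0 G\<^esub> y (k, j) = Some h)"
proof -
  let ?f = "\<lambda>k. x (i, k) \<cdot>\<^bsub>group0 G\<^esub> y (k, j)"
  have f: "?f k \<in> carrier (group0 G)" if "k \<in> {1..n}" for k
    using that ij rook_entry[OF x] rook_entry[OF y]
    by (auto simp: group0_carrier group0_mult_eq_Some_iff)
  have uniq: "k = k'" if "?f k = Some g" "?f k' = Some g'" "k \<in> {1..n}" "k' \<in> {1..n}" for k k' g g'
    using that rook_row_unique[OF x] ij by (metis group0_mult_eq_Some_iff)
  have m: "(x \<cdot>\<^bsub>rook_matrices n (group0 G)\<^esub> y) (i, j) = ojoin_family (group0 G) {1..n} ?f"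
    using ij by (simp add: rook_matrices_def)
  show ?thesis
  proof (cases "\<exists>k \<in> {1..n}. ?f k \<noteq> None")
    case True
    then obtain k g where k: "k \<in> {1..n}" "?f k = Some g" by blast
    have "ojoin_family (group0 G) {1..n} ?f = Some g"
    proof (rule group0_ojoin_family)
      show "?f ` {1..n} \<subseteq> {None, Some g}"
      proof
        fix z assume "z \<in> ?f ` {1..n}"
        then obtain k' where "k' \<in> {1..n}" "z = ?f k'" by blast
        then show "z \<in> {None, Some g}" using uniq[of k' _ k g] k by (cases "?f k'") auto
      qed
    qed (use k f in \<open>force+\<close>)
    with k uniq m show ?thesis by (metis option.inject)
  next
    case False
    then have "ojoin_family (group0 G) {1..n} ?f = None"
      by (intro group0_ojoin_family) (auto simp: group0_carrier)
    with False m show ?thesis by auto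
  qed
qed

lemma rook_mult_closed:
  assumes x: "x \<in> carrier (rook_matrices n (group0 G))"
    and y: "y \<in> carrier (rook_matrices n (group0 G))"
  shows "x \<cdot>\<^bsub>rook_matrices n (group0 G)\<^esub> y \<in> carrier (rook_matrices n (group0 G))" (is "?z \<in> _")
  unfolding rook_carrier_iff rook_matrix_group0_iff
proof (intro conjI ballI impI)
  note z = rook_mult_entry[OF x y]
  show "?z \<in> {1..n} \<times> {1..n} \<rightarrow>\<^sub>E carrier (group0 G)"
  proof (rule PiE_I)
    fix p assume "p \<in> {1..n} \<times> {1..n}"
    then obtain i j where ij: "p = (i, j)" "i \<in> {1..n}" "j \<in> {1..n}" by blast
    show "?z p \<in> carrier (group0 G)"
      unfolding ij(1) group0_carrier z[OF ij(2,3)] group0_mult_eq_Some_iff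
      using rook_entry[OF x] rook_entry[OF y] ij(2,3) by blast
  qed (auto simp: rook_matrices_def)
  fix i j k assume i: "i \<in> {1..n}" and j: "j \<in> {1..n}" and k: "k \<in> {1..n}"
    and "j \<noteq> k"
  show "?z (i, j) = None \<or> ?z (i, k) = None"
  proof (rule ccontr)
    assume "\<not> ?thesis"
    then obtain g h where "?z (i, j) = Some g" "?z (i, k) = Some h" by auto
    then have "j = k"
      unfolding z[OF i j] z[OF i k] group0_mult_eq_Some_iff
      using rook_row_unique[OF x] rook_row_unique[OF y] i j k by metis
    with \<open>j \<noteq> k\<close> show False ..
  qed
  show "?z (j, i) = None \<or> ?z (k, i) = None"
  proof (rule ccontr)
    assume "\<not> ?thesis"
    then obtain g h where "?z (j, i) = Some g" "?z (k, i) = Some h" by auto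
    then have "j = k"
      unfolding z[OF j i] z[OF k i] group0_mult_eq_Some_iff
      using rook_col_unique[OF x] rook_col_unique[OF y] i j k by metis
    with \<open>j \<noteq> k\<close> show False ..
  qed
qed

lemma rook_rel_mult:
  assumes x: "x \<in> carrier (rook_matrices n (group0 G))"
    and y: "y \<in> carrier (rook_matrices n (group0 G))"
  shows "rook_rel G n (x \<cdot>\<^bsub>rook_matrices n (group0 G)\<^esub> y) = rook_rel G n y O rook_rel G n x"
    (is "?L = ?R")
proof (intro equalityI subsetI)
  fix p assume "p \<in> ?L"
  then obtain i j h u where p: "p = ((j, u), (i, h \<otimes> u))" "i \<in> {1..n}" "j \<in> {1..n}"
    "u \<in> carrier G" "(x \<cdot>\<^bsub>rook_matrices n (group0 G)\<^esub> y) (i, j) = Some h" by (rule rook_relE)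
  then obtain k a b where k: "k \<in> {1..n}" "x (i, k) = Some a" "y (k, j) = Some b" "h = a \<otimes> b"
    by (auto simp: rook_mult_entry[OF x y] group0_mult_eq_Some_iff)
  with p have "((j, u), (k, b \<otimes> u)) \<in> rook_rel G n y" by (simp add: rook_rel_iff)
  moreover have "((k, b \<otimes> u), (i, h \<otimes> u)) \<in> rook_rel G n x"
    using p k rook_entry[OF x, of i k a] rook_entry[OF y, of k j b]
    by (simp add: rook_rel_iff m_assoc)
  ultimately show "p \<in> ?R" using p by blast
next
  fix p assume "p \<in> ?R"
  then obtain k w i v j u where p: "p = ((j, u), (i, v))" "((j, u), (k, w)) \<in> rook_rel G n y"
    "((k, w), (i, v)) \<in> rook_rel G n x" by (metis relcompE surj_pair)
  then obtain a b where r: "i \<in> {1..n}" "j \<in> {1..n}" "k \<in> {1..n}" "u \<in> carrier G"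
    "x (i, k) = Some a" "y (k, j) = Some b" "v = a \<otimes> (b \<otimes> u)" by (auto simp: rook_rel_iff)
  have "(x \<cdot>\<^bsub>rook_matrices n (group0 G)\<^esub> y) (i, j) = Some (a \<otimes> b)"
    using r unfolding rook_mult_entry[OF x y r(1,2)] group0_mult_eq_Some_iff by blast
  with r p show "p \<in> ?L"
    using rook_entry[OF x, of i k a] rook_entry[OF y, of k j b]
    by (simp add: rook_rel_iff m_assoc)
qed

lemma equivariant_bijections_converse:
  "R \<in> equivariant_bijections G J \<Longrightarrow> R\<inverse> \<in> equivariant_bijections G J"
  by (auto simp: equivariant_bijections_def equivariant_def partial_bijection_converse)

text \<open>Differences stay equivariant because translations are invertible.\<close>

lemma equivariant_bijections_diff:
  assumes R: "R \<in> equivariant_bijections G J" and Q: "Q \<in> equivariant_bijections G J"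
  shows "R - Q \<in> equivariant_bijections G J"
proof -
  have "partial_bijection (R - Q)"
    using equivariant_bijectionsD(1)[OF R] by (blast intro: partial_bijectionI dest: partial_bijection_unique)
  moreover have "equivariant G (R - Q)"
    unfolding equivariant_def
  proof (intro allI ballI impI)
    fix j u i v w assume w: "w \<in> carrier G" and uv: "((j, u), (i, v)) \<in> R - Q"
    then have c: "u \<in> carrier G" "v \<in> carrier G" using equivariant_bijectionsD(3)[OF R] by auto
    have "((j, u \<otimes> w), (i, v \<otimes> w)) \<notin> Q"
    proof
      assume "((j, u \<otimes> w), (i, v \<otimes> w)) \<in> Q"
      from equivariantD[OF equivariant_bijectionsD(2)[OF Q] this inv_closed[OF w]]
      show False using uv c w by (simp add: m_assoc)
    qed
    with uv w show "((j, u \<otimes> w), (i, v \<otimes> w)) \<in> R - Q"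
      using equivariantD[OF equivariant_bijectionsD(2)[OF R]] by blast
  qed
  ultimately show ?thesis using equivariant_bijectionsD(3)[OF R]
    by (auto simp: equivariant_bijections_def)
qed

lemma equivariant_bijections_union:
  assumes R: "R \<in> equivariant_bijections G J" and Q: "Q \<in> equivariant_bijections G J"
    and disj: "Domain R \<inter> Domain Q = {}" "Range R \<inter> Range Q = {}"
  shows "R \<union> Q \<in> equivariant_bijections G J"
proof -
  have "partial_bijection (R \<union> Q)"
    using equivariant_bijectionsD(1)[OF R] equivariant_bijectionsD(1)[OF Q] disj
    by (rule partial_bijection_Un)
  with R Q show ?thesis by (auto simp: equivariant_bijections_def equivariant_def)
qed

sublocale rook: partial_bijection_representation "rook_matrices n (group0 G)" "rook_rel G n" for n
proof
  show "inj_on (rook_rel G n) (carrier (rook_matrices n (group0 G)))" by (rule inj_rook_rel)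
next
  have "(\<lambda>(i, j) \<in> {1..n} \<times> {1..n}. None) \<in> carrier (rook_matrices n (group0 G))"
    unfolding rook_carrier_iff rook_matrix_group0_iff by (auto simp: group0_carrier)
  then show "\<zero>\<^sub>s\<^bsub>rook_matrices n (group0 G)\<^esub> \<in> carrier (rook_matrices n (group0 G))"
    by (simp add: rook_matrices_def)
  show "rook_rel G n \<zero>\<^sub>s\<^bsub>rook_matrices n (group0 G)\<^esub> = {}"
    by (auto simp: rook_matrices_def elim!: rook_relE)
qed (unfold rook_rel_image, auto simp: rook_mult_closed rook_rel_mult
    equivariant_bijections_converse equivariant_bijections_diff equivariant_bijections_union
    equivariant_bijectionsD(1)[OF rook_rel_in])

theorem rook_matrices_boolean: "boolean_inverse_semigroup (rook_matrices n (group0 G))"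
  by (rule rook.boolean_inverse_semigroup)

text \<open>From here on, identities of rook matrices are statements about equivariant partial
  bijections.\<close>

theorem rook_matrices_satisfies_iff:
  "bias_satisfies (rook_matrices n (group0 G)) \<Sigma> \<longleftrightarrow>
    (\<forall>(s, t) \<in> \<Sigma>. \<forall>V. range V \<subseteq> equivariant_bijections G {1..n} \<longrightarrow> bias_rel V s = bias_rel V t)"
  unfolding rook.bias_satisfies_iff rook_rel_image ..

lemma bias_rel_equivariant:
  assumes "range V \<subseteq> equivariant_bijections G {1..n}"
  shows "bias_rel V s \<in> equivariant_bijections G {1..n}"
proof -
  have "\<forall>k. \<exists>x \<in> carrier (rook_matrices n (group0 G)). V k = rook_rel G n x"
    using assms rook_rel_surj by blast
  then obtain v where v: "\<forall>k. v k \<in> carrier (rook_matrices n (group0 G)) \<and> V k = rook_rel G n (v k)"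
    by metis
  then have "range v \<subseteq> carrier (rook_matrices n (group0 G))" "V = (\<lambda>k. rook_rel G n (v k))" by auto
  with rook.bias_eval_closed_rep[of v n s] rook_rel_in show ?thesis by metis
qed

end

section \<open>Groups of permutations and wreath products\<close>

primrec grp_rel :: "'a set \<Rightarrow> (nat \<Rightarrow> ('a \<times> 'a) set) \<Rightarrow> group_term \<Rightarrow> ('a \<times> 'a) set" where
  "grp_rel X V (GVar k) = V k"
| "grp_rel X V GOne = Id_on X"
| "grp_rel X V (GInv s) = (grp_rel X V s)\<inverse>"
| "grp_rel X V (GMul s t) = grp_rel X V t O grp_rel X V s"

definition total_bijection :: "'a set \<Rightarrow> ('a \<times> 'a) set \<Rightarrow> bool" where
  "total_bijection X R \<longleftrightarrow> partial_bijection R \<and> Domain R = X \<and> Range R = X"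

lemma total_bijectionD:
  assumes "total_bijection X R"
  shows "partial_bijection R" "Domain R = X" "Range R = X" "R \<subseteq> X \<times> X"
  using assms by (auto simp: total_bijection_def)

lemma total_bijection_Id_on: "total_bijection X (Id_on X)"
  by (auto simp: total_bijection_def intro: partial_bijectionI)

lemma total_bijection_converse: "total_bijection X R \<Longrightarrow> total_bijection X (R\<inverse>)"
  by (auto simp: total_bijection_def partial_bijection_converse)

lemma total_bijection_relcomp:
  assumes "total_bijection X R" "total_bijection X Q"
  shows "total_bijection X (R O Q)"
  using assms unfolding total_bijection_def by (intro conjI partial_bijection_relcomp) blast+

lemma total_bijection_grp_rel:
  "(\<And>k. total_bijection X (V k)) \<Longrightarrow> total_bijection X (grp_rel X V t)"
  by (induction t)
    (simp_all add: total_bijection_Id_on total_bijection_converse total_bijection_relcomp)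

text \<open>Being a group is a consequence, not an assumption: associativity and inverses of \<open>M\<close> are inherited
  from relations, which saves a verification of the group laws for semidirect products.\<close>

locale permutation_representation =
  fixes M :: "'w monoid" and X :: "'b set" and \<omega> :: "'w \<Rightarrow> ('b \<times> 'b) set"
  assumes inj_rep: "inj_on \<omega> (carrier M)"
    and total_rep: "w \<in> carrier M \<Longrightarrow> total_bijection X (\<omega> w)"
    and mult_closed: "\<lbrakk>w \<in> carrier M; z \<in> carrier M\<rbrakk> \<Longrightarrow> w \<otimes>\<^bsub>M\<^esub> z \<in> carrier M"
    and rep_mult: "\<lbrakk>w \<in> carrier M; z \<in> carrier M\<rbrakk> \<Longrightarrow> \<omega> (w \<otimes>\<^bsub>M\<^esub> z) = \<omega> z O \<omega> w"
    and one_closed: "\<one>\<^bsub>M\<^esub> \<in> carrier M"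
    and rep_one: "\<omega> \<one>\<^bsub>M\<^esub> = Id_on X"
    and converse_in_image: "w \<in> carrier M \<Longrightarrow> (\<omega> w)\<inverse> \<in> \<omega> ` carrier M"
begin

lemma rep_eq_iff: "\<lbrakk>w \<in> carrier M; z \<in> carrier M\<rbrakk> \<Longrightarrow> \<omega> w = \<omega> z \<longleftrightarrow> w = z"
  using inj_rep by (rule inj_on_eq_iff)

lemma ex_rep_inverse:
  assumes w: "w \<in> carrier M"
  shows "\<exists>z \<in> carrier M. \<omega> z = (\<omega> w)\<inverse> \<and> z \<otimes>\<^bsub>M\<^esub> w = \<one>\<^bsub>M\<^esub>"
proof -
  obtain z where z: "z \<in> carrier M" "\<omega> z = (\<omega> w)\<inverse>" using converse_in_image[OF w] by auto
  have "\<omega> (z \<otimes>\<^bsub>M\<^esub> w) = \<omega> \<one>\<^bsub>M\<^esub>"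
    using w z total_bijectionD[OF total_rep[OF w]]
    by (simp add: rep_mult rep_one partial_bijection_dom)
  with w z show ?thesis by (metis rep_eq_iff mult_closed one_closed)
qed

sublocale group M
proof (rule groupI)
  fix x assume x: "x \<in> carrier M"
  then show "\<exists>y \<in> carrier M. y \<otimes>\<^bsub>M\<^esub> x = \<one>\<^bsub>M\<^esub>" using ex_rep_inverse by blast
  have "Id_on X = Id_on (Range (\<omega> x))" using total_bijectionD(3)[OF total_rep[OF x]] by simp
  then have "\<omega> (\<one>\<^bsub>M\<^esub> \<otimes>\<^bsub>M\<^esub> x) = \<omega> x" using x by (auto simp: rep_mult rep_one one_closed)
  with x show "\<one>\<^bsub>M\<^esub> \<otimes>\<^bsub>M\<^esub> x = x" by (simp add: rep_eq_iff mult_closed one_closed)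
qed (auto simp: mult_closed one_closed rep_eq_iff[symmetric] rep_mult O_assoc)

lemma rep_inv:
  assumes "w \<in> carrier M"
  shows "\<omega> (inv\<^bsub>M\<^esub> w) = (\<omega> w)\<inverse>"
  using ex_rep_inverse[OF assms] assms by (metis inv_equality)

lemma group_eval_closed_rep:
  assumes "range v \<subseteq> carrier M"
  shows "group_eval M v t \<in> carrier M \<and> \<omega> (group_eval M v t) = grp_rel X (\<lambda>k. \<omega> (v k)) t"
proof (induction t)
  case (GVar k) show ?case using assms by auto
qed (simp_all add: rep_one rep_inv rep_mult)

lemma group_eval_eq_iff:
  assumes "range v \<subseteq> carrier M"
  shows "group_eval M v s = group_eval M v t \<longleftrightarrow>
    grp_rel X (\<lambda>k. \<omega> (v k)) s = grp_rel X (\<lambda>k. \<omega> (v k)) t"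
  using group_eval_closed_rep[OF assms] by (metis rep_eq_iff)

end

text \<open>The left regular representation.\<close>

definition translation_rel :: "'g monoid \<Rightarrow> 'g \<Rightarrow> ('g \<times> 'g) set" where
  "translation_rel G h = {(u, h \<otimes>\<^bsub>G\<^esub> u) | u. u \<in> carrier G}"

lemma (in plain_group) translation_representation:
  "permutation_representation G (carrier G) (translation_rel G)"
proof
  show "inj_on (translation_rel G) (carrier G)"
  proof (rule inj_onI)
    fix g h assume "g \<in> carrier G" "h \<in> carrier G" "translation_rel G g = translation_rel G h"
    moreover from this have "(\<one>, g) \<in> translation_rel G h"
      unfolding translation_rel_def by force
    ultimately show "g = h" unfolding translation_rel_def by auto
  qed
  have mem: "(u, v) \<in> translation_rel G g \<longleftrightarrow> u \<in> carrier G \<and> v = g \<otimes> u" for g u v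
    unfolding translation_rel_def by blast
  show "total_bijection (carrier G) (translation_rel G g)" if g: "g \<in> carrier G" for g
    unfolding total_bijection_def
  proof (intro conjI partial_bijectionI)
    show "Domain (translation_rel G g) = carrier G" by (auto simp: mem Domain_iff)
    have "v = g \<otimes> (inv g \<otimes> v)" if "v \<in> carrier G" for v
      using that g by (simp add: m_assoc[symmetric])
    then show "Range (translation_rel G g) = carrier G"
      using g by (auto simp: mem Range_iff) (metis inv_closed m_closed)
  qed (use g in \<open>auto simp: mem\<close>)
  show "translation_rel G (g \<otimes> h) = translation_rel G h O translation_rel G g"
    if "g \<in> carrier G" "h \<in> carrier G" for g h
    using that by (auto simp: mem m_assoc)
  show "translation_rel G \<one> = Id_on (carrier G)" by (auto simp: mem)
  show "(translation_rel G g)\<inverse> \<in> translation_rel G ` carrier G" if g: "g \<in> carrier G" for g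
  proof
    show "(translation_rel G g)\<inverse> = translation_rel G (inv g)"
      using g by (auto simp: mem m_assoc[symmetric])
  qed (use g in simp)
qed auto

text \<open>The imprimitive action of the wreath product on \<open>{1..k} \<times> G\<close>: first the permutation moves the
  block, then the entry at the new block acts on the label.\<close>

definition wreath_rel :: "'g monoid \<Rightarrow> nat \<Rightarrow> (nat \<Rightarrow> 'g) \<times> (nat \<Rightarrow> nat) \<Rightarrow>
    ((nat \<times> 'g) \<times> (nat \<times> 'g)) set" where
  "wreath_rel G k w = {((b, u), (snd w b, fst w (snd w b) \<otimes>\<^bsub>G\<^esub> u)) | b u.
    b \<in> {1..k} \<and> u \<in> carrier G}"

lemma wreath_rel_iff:
  "((b, u), (c, v)) \<in> wreath_rel G k (g, p) \<longleftrightarrow>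
    b \<in> {1..k} \<and> u \<in> carrier G \<and> c = p b \<and> v = g c \<otimes>\<^bsub>G\<^esub> u"
  unfolding wreath_rel_def by auto

lemma wreath_carrier_iff:
  "(g, p) \<in> carrier (wreath_sym G k) \<longleftrightarrow> g \<in> {1..k} \<rightarrow>\<^sub>E carrier G \<and> p permutes {1..k}"
  by (simp add: wreath_sym_def sym_group_carrier)

lemma wreath_one: "\<one>\<^bsub>wreath_sym G k\<^esub> = ((\<lambda>i \<in> {1..k}. \<one>\<^bsub>G\<^esub>), id)"
  by (simp add: wreath_sym_def sym_group_one)

lemma wreath_mult: "(g, p) \<otimes>\<^bsub>wreath_sym G k\<^esub> (h, q) =
    ((\<lambda>i \<in> {1..k}. g i \<otimes>\<^bsub>G\<^esub> h (inv_into UNIV p i)), p \<circ> q)"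
  by (auto simp: wreath_sym_def sym_group_mult fun_eq_iff)

definition equivariant_permutations ::
    "'g monoid \<Rightarrow> nat \<Rightarrow> ((nat \<times> 'g) \<times> (nat \<times> 'g)) set set" where
  "equivariant_permutations G k =
    {R \<in> equivariant_bijections G {1..k}. total_bijection ({1..k} \<times> carrier G) R}"

context plain_group
begin

lemma wreath_rel_in:
  assumes "w \<in> carrier (wreath_sym G k)"
  shows "wreath_rel G k w \<in> equivariant_permutations G k"
proof -
  obtain g p where w: "w = (g, p)" by (cases w)
  with assms have p: "p permutes {1..k}" and g: "\<And>i. i \<in> {1..k} \<Longrightarrow> g i \<in> carrier G"
    by (auto simp: wreath_carrier_iff)
  have pk: "p b \<in> {1..k} \<longleftrightarrow> b \<in> {1..k}" for b using permutes_in_image[OF p] .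
  have pb: "partial_bijection (wreath_rel G k w)"
  proof (rule partial_bijectionI)
    fix x y z assume "(x, y) \<in> wreath_rel G k w" "(x, z) \<in> wreath_rel G k w"
    then show "y = z" by (cases x; cases y; cases z) (simp add: w wreath_rel_iff)
  next
    fix x y z assume xz: "(x, z) \<in> wreath_rel G k w" and yz: "(y, z) \<in> wreath_rel G k w"
    obtain b u b' u' c v where e: "x = (b, u)" "y = (b', u')" "z = (c, v)" by (metis surj_pair)
    have r: "b \<in> {1..k}" "u \<in> carrier G" "c = p b" "v = g c \<otimes> u"
      "b' \<in> {1..k}" "u' \<in> carrier G" "c = p b'" "v = g c \<otimes> u'"
      using xz[unfolded e w wreath_rel_iff] yz[unfolded e w wreath_rel_iff] by blast+
    then have "b = b'" using permutes_inj[OF p] by (metis injD)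
    moreover have "u = u'" using r g[of c] pk[of b] by (metis Units_eq Units_l_cancel)
    ultimately show "x = y" using e by simp
  qed
  have "Range (wreath_rel G k w) = {1..k} \<times> carrier G"
  proof (intro equalityI subsetI)
    fix z assume "z \<in> {1..k} \<times> carrier G"
    then obtain c v where z: "z = (c, v)" "c \<in> {1..k}" "v \<in> carrier G" by blast
    obtain b where b: "p b = c" using permutes_surj[OF p] by (metis surjD)
    then have "((b, inv (g c) \<otimes> v), (c, v)) \<in> wreath_rel G k w"
      using z g[of c] pk[of b] by (simp add: w wreath_rel_iff m_assoc[symmetric])
    then show "z \<in> Range (wreath_rel G k w)" using z by blast
  next
    fix z assume "z \<in> Range (wreath_rel G k w)"
    then obtain b u c v where "z = (c, v)" "((b, u), (c, v)) \<in> wreath_rel G k w"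
      by (metis RangeE surj_pair)
    then show "z \<in> {1..k} \<times> carrier G" using g[of c] pk[of b] by (auto simp: w wreath_rel_iff)
  qed
  moreover have "Domain (wreath_rel G k w) = {1..k} \<times> carrier G"
    unfolding wreath_rel_def by blast
  moreover have "equivariant G (wreath_rel G k w)"
    unfolding equivariant_def using g pk by (auto simp: w wreath_rel_iff m_assoc)
  ultimately show ?thesis
    using pb unfolding equivariant_permutations_def equivariant_bijections_def total_bijection_def
    by auto
qed

text \<open>The wreath product is the full centralizer of the right translations: an equivariant
  permutation is a rook matrix without zero column, and in such a matrix the positions of the nonzero
  entries form a permutation.\<close>

lemma wreath_rel_surj:
  assumes R: "R \<in> equivariant_permutations G k"
  shows "R \<in> wreath_rel G k ` carrier (wreath_sym G k)"
proof -
  have "R \<in> equivariant_bijections G {1..k}" and D: "Domain R = {1..k} \<times> carrier G"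
    using R by (auto simp: equivariant_permutations_def total_bijection_def)
  then obtain x where x: "x \<in> carrier (rook_matrices k (group0 G))" and Rx: "R = rook_rel G k x"
    using rook_rel_surj by blast
  have "\<exists>i \<in> {1..k}. \<exists>h \<in> carrier G. x (i, b) = Some h" if b: "b \<in> {1..k}" for b
  proof -
    have "(b, \<one>) \<in> Domain R" using b D by simp
    then obtain i v where "((b, \<one>), (i, v)) \<in> R" by (metis DomainE surj_pair)
    then show ?thesis using rook_rel_one_iff[OF x] rook_entry[OF x] Rx by blast
  qed
  then obtain q h where qh: "\<And>b. b \<in> {1..k} \<Longrightarrow> q b \<in> {1..k} \<and> h b \<in> carrier G \<and> x (q b, b) = Some (h b)"
    by metis
  define p where "p b = (if b \<in> {1..k} then q b else b)" for b
  have p: "p permutes {1..k}"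
  proof (rule bij_imp_permutes)
    have "inj_on p {1..k}"
      using qh rook_row_unique[OF x] by (intro inj_onI) (metis p_def)
    moreover have "p ` {1..k} \<subseteq> {1..k}" using qh by (auto simp: p_def)
    ultimately show "bij_betw p {1..k} {1..k}"
      by (simp add: bij_betw_def endo_inj_surj)
  qed (auto simp: p_def)
  define g where "g = (\<lambda>i \<in> {1..k}. h (inv_into UNIV p i))"
  have gp: "g (p b) = h b" if "b \<in> {1..k}" for b
    using that permutes_in_image[OF p] permutes_inverses(2)[OF p] by (simp add: g_def)
  have "inv_into UNIV p i \<in> {1..k}" if "i \<in> {1..k}" for i
    using that permutes_in_image[OF permutes_inv[OF p]] by blast
  then have w: "(g, p) \<in> carrier (wreath_sym G k)"
    using qh p by (auto simp: wreath_carrier_iff g_def)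
  have "x (i, b) = Some a \<longleftrightarrow> i = p b \<and> a = g i" if "b \<in> {1..k}" "i \<in> {1..k}" for i b a
    using that qh[OF that(1)] gp[OF that(1)] rook_col_unique[OF x] by (metis option.inject p_def)
  then have "((b, u), (i, v)) \<in> R \<longleftrightarrow> ((b, u), (i, v)) \<in> wreath_rel G k (g, p)" for b u i v
    using permutes_in_image[OF p, of b] unfolding Rx rook_rel_iff wreath_rel_iff by metis
  then have "R = wreath_rel G k (g, p)" by (auto simp: set_eq_iff)
  with w show ?thesis by blast
qed

lemma wreath_representation:
  "permutation_representation (wreath_sym G k) ({1..k} \<times> carrier G) (wreath_rel G k)"
proof
  show "inj_on (wreath_rel G k) (carrier (wreath_sym G k))"
  proof (rule inj_onI)
    fix w z assume w: "w \<in> carrier (wreath_sym G k)" and z: "z \<in> carrier (wreath_sym G k)"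
      and eq: "wreath_rel G k w = wreath_rel G k z"
    obtain g p h q where wz: "w = (g, p)" "z = (h, q)" by (metis surj_pair)
    have p: "p permutes {1..k}" "q permutes {1..k}"
      and g: "g \<in> {1..k} \<rightarrow>\<^sub>E carrier G" "h \<in> {1..k} \<rightarrow>\<^sub>E carrier G"
      using w z by (auto simp: wz wreath_carrier_iff)
    have gc: "g i \<in> carrier G" "h i \<in> carrier G" if "i \<in> {1..k}" for i
      using PiE_mem[OF g(1) that] PiE_mem[OF g(2) that] .
    have *: "p b = q b \<and> g (p b) = h (p b)" if b: "b \<in> {1..k}" for b
    proof -
      have "((b, \<one>), (p b, g (p b))) \<in> wreath_rel G k w"
        using b gc[of "p b"] permutes_in_image[OF p(1), of b]
        unfolding wz wreath_rel_iff by simp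
      then have "((b, \<one>), (p b, g (p b))) \<in> wreath_rel G k z" unfolding eq .
      then have "p b = q b" "g (p b) = h (p b) \<otimes> \<one>" unfolding wz wreath_rel_iff by blast+
      then show ?thesis
        using b gc[of "p b"] permutes_in_image[OF p(1), of b] by simp
    qed
    have "p = q"
      using * p by (intro ext) (metis permutes_not_in)
    moreover have "g i = h i" if "i \<in> {1..k}" for i
      using *[of "inv_into UNIV p i"] permutes_inverses(1)[OF p(1)] that
        permutes_in_image[OF permutes_inv[OF p(1)], of i] by simp
    then have "g = h" using g by (intro PiE_ext)
    ultimately show "w = z" by (simp add: wz)
  qed
next
  fix w z assume w: "w \<in> carrier (wreath_sym G k)" and z: "z \<in> carrier (wreath_sym G k)"
  obtain g p h q where wz: "w = (g, p)" "z = (h, q)" by (metis surj_pair)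
  have p: "p permutes {1..k}" "q permutes {1..k}"
    and g: "g \<in> {1..k} \<rightarrow>\<^sub>E carrier G" "h \<in> {1..k} \<rightarrow>\<^sub>E carrier G"
    using w z by (auto simp: wz wreath_carrier_iff)
  have gc: "g i \<in> carrier G" "h i \<in> carrier G" if "i \<in> {1..k}" for i
    using PiE_mem[OF g(1) that] PiE_mem[OF g(2) that] .
  have ip: "inv_into UNIV p i \<in> {1..k} \<longleftrightarrow> i \<in> {1..k}" for i
    using permutes_in_image[OF permutes_inv[OF p(1)]] .
  have "(\<lambda>i \<in> {1..k}. g i \<otimes> h (inv_into UNIV p i)) \<in> {1..k} \<rightarrow>\<^sub>E carrier G"
    using gc ip by auto
  then show "w \<otimes>\<^bsub>wreath_sym G k\<^esub> z \<in> carrier (wreath_sym G k)"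
    unfolding wz wreath_mult wreath_carrier_iff using permutes_compose[OF p(2,1)] by simp
  have pk: "p b \<in> {1..k} \<longleftrightarrow> b \<in> {1..k}" "q b \<in> {1..k} \<longleftrightarrow> b \<in> {1..k}" for b
    using permutes_in_image[OF p(1)] permutes_in_image[OF p(2)] by blast+
  show "wreath_rel G k (w \<otimes>\<^bsub>wreath_sym G k\<^esub> z) = wreath_rel G k z O wreath_rel G k w"
    (is "?L = ?R")
  proof (intro equalityI subsetI)
    fix e assume "e \<in> ?L"
    then obtain b u c v where e: "e = ((b, u), (c, v))" and bu: "((b, u), (c, v)) \<in> ?L"
      by (metis surj_pair)
    then have r: "b \<in> {1..k}" "u \<in> carrier G" "c = p (q b)"
      "v = (g (p (q b)) \<otimes> h (q b)) \<otimes> u"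
      using pk permutes_inverses(2)[OF p(1)] by (auto simp: wz wreath_mult wreath_rel_iff)
    then have "((b, u), (q b, h (q b) \<otimes> u)) \<in> wreath_rel G k z"
      "((q b, h (q b) \<otimes> u), (c, v)) \<in> wreath_rel G k w"
      using pk gc[of "q b"] gc[of "p (q b)"] by (simp_all add: wz wreath_rel_iff m_assoc)
    then show "e \<in> ?R" unfolding e by blast
  next
    fix e assume "e \<in> ?R"
    then obtain b u c v d x where e: "e = ((b, u), (c, v))" "((b, u), (d, x)) \<in> wreath_rel G k z"
      "((d, x), (c, v)) \<in> wreath_rel G k w" by (metis relcompE surj_pair)
    then have r: "b \<in> {1..k}" "u \<in> carrier G" "c = p (q b)" "v = g (p (q b)) \<otimes> (h (q b) \<otimes> u)"
      by (auto simp: wz wreath_rel_iff)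
    then show "e \<in> ?L"
      using pk[of "q b"] pk[of b] gc[of "q b"] gc[of "p (q b)"] permutes_inverses(2)[OF p(1)]
      by (simp add: e(1) wz wreath_mult wreath_rel_iff m_assoc)
  qed
next
  show "\<one>\<^bsub>wreath_sym G k\<^esub> \<in> carrier (wreath_sym G k)"
    by (simp add: wreath_one wreath_carrier_iff permutes_id)
  show "wreath_rel G k \<one>\<^bsub>wreath_sym G k\<^esub> = Id_on ({1..k} \<times> carrier G)"
    by (auto simp: wreath_one wreath_rel_iff)
next
  fix w assume "w \<in> carrier (wreath_sym G k)"
  then have w: "wreath_rel G k w \<in> equivariant_permutations G k" by (rule wreath_rel_in)
  then show "total_bijection ({1..k} \<times> carrier G) (wreath_rel G k w)"
    by (simp add: equivariant_permutations_def)
  from w have "(wreath_rel G k w)\<inverse> \<in> equivariant_permutations G k"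
    by (simp add: equivariant_permutations_def equivariant_bijections_converse
        total_bijection_converse)
  then show "(wreath_rel G k w)\<inverse> \<in> wreath_rel G k ` carrier (wreath_sym G k)"
    by (rule wreath_rel_surj)
qed

sublocale wreath: permutation_representation "wreath_sym G k" "{1..k} \<times> carrier G" "wreath_rel G k"
  for k by (rule wreath_representation)

lemma grp_rel_equivariant:
  assumes "range v \<subseteq> carrier (wreath_sym G k)"
  shows "grp_rel ({1..k} \<times> carrier G) (\<lambda>l. wreath_rel G k (v l)) t \<in> equivariant_permutations G k"
  using wreath.group_eval_closed_rep[OF assms, of t] wreath_rel_in by metis

text \<open>Since every equivariant permutation comes from the wreath product, its identities can be used
  for arbitrary valuations by equivariant permutations.\<close>

lemma wreath_identity:
  assumes sat: "group_satisfies (wreath_sym G k) {(p, q)}"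
    and V: "range V \<subseteq> equivariant_permutations G k"
  shows "grp_rel ({1..k} \<times> carrier G) V p = grp_rel ({1..k} \<times> carrier G) V q"
proof -
  have "\<forall>l. \<exists>w \<in> carrier (wreath_sym G k). V l = wreath_rel G k w"
    using V wreath_rel_surj by blast
  then obtain v where v: "\<forall>l. v l \<in> carrier (wreath_sym G k) \<and> V l = wreath_rel G k (v l)" by metis
  then have r: "range v \<subseteq> carrier (wreath_sym G k)" and "V = (\<lambda>l. wreath_rel G k (v l))" by auto
  moreover have "group_eval (wreath_sym G k) v p = group_eval (wreath_sym G k) v q"
    using sat r by (simp add: group_satisfies_def)
  ultimately show ?thesis using wreath.group_eval_eq_iff[OF r] by simp
qed

end

section \<open>Transport of relations along injections\<close>

definition image_rel :: "('a \<Rightarrow> 'b) \<Rightarrow> ('a \<times> 'a) set \<Rightarrow> ('b \<times> 'b) set" where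
  "image_rel f R = map_prod f f ` R"

lemma image_rel_iff: "(x, y) \<in> image_rel f R \<longleftrightarrow> (\<exists>a b. x = f a \<and> y = f b \<and> (a, b) \<in> R)"
  unfolding image_rel_def by auto

lemma image_rel_relcomp:
  assumes "inj_on f D" "R \<subseteq> D \<times> D" "Q \<subseteq> D \<times> D"
  shows "image_rel f (R O Q) = image_rel f R O image_rel f Q"
proof (intro equalityI subsetI)
  fix p assume "p \<in> image_rel f R O image_rel f Q"
  then obtain x y z where p: "p = (x, z)" "(x, y) \<in> image_rel f R" "(y, z) \<in> image_rel f Q" by auto
  then obtain a b c d where r: "x = f a" "y = f b" "(a, b) \<in> R" "y = f c" "z = f d" "(c, d) \<in> Q"
    unfolding image_rel_iff by blast
  with assms have "b = c" by (metis inj_onD mem_Sigma_iff subsetD)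
  with p r show "p \<in> image_rel f (R O Q)" by (auto simp: image_rel_iff)
qed (force simp: image_rel_def)

lemma image_rel_converse: "image_rel f (R\<inverse>) = (image_rel f R)\<inverse>"
  by (force simp: image_rel_def)

lemma image_rel_Un: "image_rel f (R \<union> Q) = image_rel f R \<union> image_rel f Q"
  by (simp add: image_rel_def image_Un)

lemma Domain_image_rel: "Domain (image_rel f R) = f ` Domain R"
  and Range_image_rel: "Range (image_rel f R) = f ` Range R"
  by (force simp: image_rel_def)+

lemma image_rel_Id_on: "image_rel f (Id_on A) = Id_on (f ` A)"
  by (force simp: image_rel_def)

lemma image_rel_skew_diff:
  assumes f: "inj_on f D" and R: "R \<subseteq> D \<times> D" and Q: "Q \<subseteq> D \<times> D"
  shows "image_rel f (rel_skew_diff R Q) = rel_skew_diff (image_rel f R) (image_rel f Q)"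
proof -
  have "f a \<in> f ` Domain Q \<longleftrightarrow> a \<in> Domain Q" "f b \<in> f ` Range Q \<longleftrightarrow> b \<in> Range Q"
    if "(a, b) \<in> R" for a b
    using that R Q by (auto intro!: inj_on_image_mem_iff[OF f])
  then have "(x, y) \<in> image_rel f (rel_skew_diff R Q) \<longleftrightarrow>
      (\<exists>a b. x = f a \<and> y = f b \<and> (a, b) \<in> R \<and> f a \<notin> f ` Domain Q \<and> f b \<notin> f ` Range Q)" for x y
    unfolding image_rel_iff rel_skew_diff_def by blast
  also have "\<dots> x y \<longleftrightarrow> (x, y) \<in> rel_skew_diff (image_rel f R) (image_rel f Q)" for x y
    unfolding rel_skew_diff_def Domain_image_rel Range_image_rel mem_Collect_eq prod.case
      image_rel_iff by auto
  finally show ?thesis by (auto simp: set_eq_iff)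
qed

lemma inj_on_image_rel:
  assumes f: "inj_on f D" and R: "R \<subseteq> D \<times> D" and Q: "Q \<subseteq> D \<times> D"
    and eq: "image_rel f R = image_rel f Q"
  shows "R = Q"
proof -
  have "inj_on (map_prod f f) (D \<times> D)" using f by (simp add: map_prod_inj_on)
  with R Q eq show ?thesis unfolding image_rel_def by (simp add: inj_on_image_eq_iff)
qed

lemma partial_bijection_image_rel:
  assumes f: "inj_on f D" and R: "R \<subseteq> D \<times> D" and pb: "partial_bijection R"
  shows "partial_bijection (image_rel f R)"
proof (rule partial_bijectionI)
  fix x y z assume "(x, y) \<in> image_rel f R" "(x, z) \<in> image_rel f R"
  then obtain a b a' c where r: "x = f a" "y = f b" "(a, b) \<in> R" "x = f a'" "z = f c" "(a', c) \<in> R"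
    unfolding image_rel_iff by blast
  with f R have "a = a'" by (metis inj_onD mem_Sigma_iff subsetD)
  with r pb show "y = z" by (metis partial_bijection_right_unique)
next
  fix x y z assume "(x, z) \<in> image_rel f R" "(y, z) \<in> image_rel f R"
  then obtain a b c b' where r: "x = f a" "z = f b" "(a, b) \<in> R" "y = f c" "z = f b'" "(c, b') \<in> R"
    unfolding image_rel_iff by blast
  with f R have "b = b'" by (metis inj_onD mem_Sigma_iff subsetD)
  with r pb show "x = y" by (metis partial_bijection_left_unique)
qed

lemma bias_rel_subset: "(\<And>k. V k \<subseteq> D \<times> D) \<Longrightarrow> bias_rel V s \<subseteq> D \<times> D"
  by (induction s) (force simp: rel_skew_diff_def)+

lemma bias_rel_image:
  assumes f: "inj_on f D" and V: "\<And>k. V k \<subseteq> D \<times> D"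
  shows "bias_rel (\<lambda>k. image_rel f (V k)) s = image_rel f (bias_rel V s)"
proof (induction s)
  case BZero show ?case by (simp add: image_rel_def)
qed (simp_all add: image_rel_converse image_rel_Un
    image_rel_relcomp[OF f bias_rel_subset[where V = V] bias_rel_subset[where V = V], OF V V]
    image_rel_skew_diff[OF f bias_rel_subset[where V = V] bias_rel_subset[where V = V], OF V V])

section \<open>Bias terms evaluated to matrices of group terms\<close>

text \<open>Group terms serve as entries, so that one symbolic computation covers all groups at once.
  Positions range over all pairs of numbers; the order of the matrix is a bound on the support of the
  patterns in use.\<close>

type_synonym pattern = "nat \<times> nat \<Rightarrow> group_term option"

definition rook_pattern :: "pattern \<Rightarrow> bool" where
  "rook_pattern \<sigma> \<longleftrightarrow> (\<forall>i j k. (\<sigma> (i, j) \<noteq> None \<and> \<sigma> (i, k) \<noteq> None \<longrightarrow> j = k) \<and>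
    (\<sigma> (j, i) \<noteq> None \<and> \<sigma> (k, i) \<noteq> None \<longrightarrow> j = k))"

lemma rook_patternD:
  assumes "rook_pattern \<sigma>"
  shows "\<sigma> (i, j) = Some w \<Longrightarrow> \<sigma> (i, k) = Some z \<Longrightarrow> j = k"
    and "\<sigma> (j, i) = Some w \<Longrightarrow> \<sigma> (k, i) = Some z \<Longrightarrow> j = k"
  using assms unfolding rook_pattern_def by (metis option.distinct(1))+

lemma rook_patternI:
  assumes "\<And>i j k w z. \<sigma> (i, j) = Some w \<Longrightarrow> \<sigma> (i, k) = Some z \<Longrightarrow> j = k"
    and "\<And>i j k w z. \<sigma> (j, i) = Some w \<Longrightarrow> \<sigma> (k, i) = Some z \<Longrightarrow> j = k"
  shows "rook_pattern \<sigma>"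
  unfolding rook_pattern_def using assms by (metis option.exhaust)

text \<open>For rook patterns at most one index \<open>k\<close> contributes to an entry, so the choice is unique
  (\<open>pattern_mult_Some_iff\<close>).\<close>

definition pattern_mult :: "pattern \<Rightarrow> pattern \<Rightarrow> pattern" where
  "pattern_mult \<sigma> \<tau> = (\<lambda>(i, j).
    if \<exists>k a b. \<sigma> (i, k) = Some a \<and> \<tau> (k, j) = Some b
    then Some (SOME w. \<exists>k a b. \<sigma> (i, k) = Some a \<and> \<tau> (k, j) = Some b \<and> w = GMul a b)
    else None)"

definition pattern_diff :: "pattern \<Rightarrow> pattern \<Rightarrow> pattern" where
  "pattern_diff \<sigma> \<tau> = (\<lambda>(i, j).
    if (\<exists>i'. \<tau> (i', j) \<noteq> None) \<or> (\<exists>j'. \<tau> (i, j') \<noteq> None) then None else \<sigma> (i, j))"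

primrec bias_pattern :: "(nat \<Rightarrow> pattern) \<Rightarrow> bias_term \<Rightarrow> pattern" where
  "bias_pattern \<pi> (BVar k) = \<pi> k"
| "bias_pattern \<pi> BZero = (\<lambda>_. None)"
| "bias_pattern \<pi> (BInv s) = (\<lambda>(i, j). map_option GInv (bias_pattern \<pi> s (j, i)))"
| "bias_pattern \<pi> (BMul s t) = pattern_mult (bias_pattern \<pi> s) (bias_pattern \<pi> t)"
| "bias_pattern \<pi> (BDiff s t) = pattern_diff (bias_pattern \<pi> s) (bias_pattern \<pi> t)"
| "bias_pattern \<pi> (BAdd s t) = (\<lambda>p. case bias_pattern \<pi> t p of
      Some w \<Rightarrow> Some w | None \<Rightarrow> pattern_diff (bias_pattern \<pi> s) (bias_pattern \<pi> t) p)"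

lemma pattern_mult_Some_iff:
  assumes "rook_pattern \<sigma>"
  shows "pattern_mult \<sigma> \<tau> (i, j) = Some w \<longleftrightarrow>
    (\<exists>k a b. \<sigma> (i, k) = Some a \<and> \<tau> (k, j) = Some b \<and> w = GMul a b)" (is "_ \<longleftrightarrow> ?P w")
proof -
  define P where "P = ?P"
  have uniq: "z = w" if "P w" "P z" for w z
    using that rook_patternD(1)[OF assms] unfolding P_def by (metis option.inject)
  have "(\<exists>k a b. \<sigma> (i, k) = Some a \<and> \<tau> (k, j) = Some b) \<longleftrightarrow> (\<exists>w. P w)"
    unfolding P_def by blast
  then have mult: "pattern_mult \<sigma> \<tau> (i, j) = (if \<exists>w. P w then Some (SOME w. P w) else None)"
    unfolding pattern_mult_def split P_def by presburger
  have "(SOME w. P w) = z" if "P z" for z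
    using that uniq by blast
  then have "pattern_mult \<sigma> \<tau> (i, j) = Some w \<longleftrightarrow> P w"
    unfolding mult by auto
  then show ?thesis by (simp only: P_def)
qed

lemma pattern_diff_Some_iff:
  "pattern_diff \<sigma> \<tau> (i, j) = Some w \<longleftrightarrow>
    \<sigma> (i, j) = Some w \<and> (\<forall>i'. \<tau> (i', j) = None) \<and> (\<forall>j'. \<tau> (i, j') = None)"
  unfolding pattern_diff_def by auto

lemma pattern_add_Some_iff:
  "(case \<tau> (i, j) of Some w \<Rightarrow> Some w | None \<Rightarrow> pattern_diff \<sigma> \<tau> (i, j)) = Some w \<longleftrightarrow>
    \<tau> (i, j) = Some w \<or> pattern_diff \<sigma> \<tau> (i, j) = Some w"
  by (auto simp: pattern_diff_Some_iff split: option.splits)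

lemma rook_pattern_diff:
  assumes "rook_pattern \<sigma>"
  shows "rook_pattern (pattern_diff \<sigma> \<tau>)"
  by (rule rook_patternI; unfold pattern_diff_Some_iff; elim conjE)
    (erule (1) rook_patternD[OF assms])+

lemma rook_pattern_add:
  assumes \<sigma>: "rook_pattern \<sigma>" and \<tau>: "rook_pattern \<tau>"
  shows "rook_pattern (\<lambda>p. case \<tau> p of Some w \<Rightarrow> Some w | None \<Rightarrow> pattern_diff \<sigma> \<tau> p)"
proof (rule rook_patternI; unfold pattern_add_Some_iff pattern_diff_Some_iff)
  fix i j k w z
  assume "\<tau> (i, j) = Some w \<or> \<sigma> (i, j) = Some w \<and> (\<forall>i'. \<tau> (i', j) = None) \<and> (\<forall>j'. \<tau> (i, j') = None)"
    "\<tau> (i, k) = Some z \<or> \<sigma> (i, k) = Some z \<and> (\<forall>i'. \<tau> (i', k) = None) \<and> (\<forall>j'. \<tau> (i, j') = None)"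
  then show "j = k"
    using rook_patternD(1)[OF \<sigma>, of i j w k z] rook_patternD(1)[OF \<tau>, of i j w k z] by auto
next
  fix i j k w z
  assume "\<tau> (j, i) = Some w \<or> \<sigma> (j, i) = Some w \<and> (\<forall>i'. \<tau> (i', i) = None) \<and> (\<forall>j'. \<tau> (j, j') = None)"
    "\<tau> (k, i) = Some z \<or> \<sigma> (k, i) = Some z \<and> (\<forall>i'. \<tau> (i', i) = None) \<and> (\<forall>j'. \<tau> (k, j') = None)"
  then show "j = k"
    using rook_patternD(2)[OF \<sigma>, of j i w k z] rook_patternD(2)[OF \<tau>, of j i w k z] by auto
qed

lemma rook_pattern_bias_pattern:
  assumes "\<And>k. rook_pattern (\<pi> k)"
  shows "rook_pattern (bias_pattern \<pi> s)"
proof (induction s)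
  case (BInv s) then show ?case by (simp add: rook_pattern_def)
next
  case (BMul s t)
  note m = pattern_mult_Some_iff[OF BMul.IH(1)]
  show ?case
  proof (rule rook_patternI; unfold bias_pattern.simps m; elim exE conjE)
    fix i j k l l' a a' b b'
    assume *: "bias_pattern \<pi> s (i, l) = Some a" "bias_pattern \<pi> t (l, j) = Some b"
      "bias_pattern \<pi> s (i, l') = Some a'" "bias_pattern \<pi> t (l', k) = Some b'"
    have "l = l'" by (rule rook_patternD(1)[OF BMul.IH(1) *(1,3)])
    then show "j = k" using rook_patternD(1)[OF BMul.IH(2) *(2)] *(4) by blast
  next
    fix i j k l l' a a' b b'
    assume *: "bias_pattern \<pi> s (j, l) = Some a" "bias_pattern \<pi> t (l, i) = Some b"
      "bias_pattern \<pi> s (k, l') = Some a'" "bias_pattern \<pi> t (l', i) = Some b'"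
    have "l = l'" by (rule rook_patternD(2)[OF BMul.IH(2) *(2,4)])
    then show "j = k" using rook_patternD(2)[OF BMul.IH(1) *(1)] *(3) by blast
  qed
next
  case (BDiff s t) then show ?case by (simp add: rook_pattern_diff)
next
  case (BAdd s t) then show ?case by (simp add: rook_pattern_add)
qed (simp_all add: assms, simp add: rook_pattern_def)

text \<open>A matrix of group terms acts on \<open>n\<close> copies of \<open>X\<close> once the group variables are permutations of
  \<open>X\<close>. With \<open>X = G\<close> and left translations this is the action of a rook matrix over \<open>G\<close>; with
  \<open>X = {1..k} \<times> H\<close> it is the action of a block matrix.\<close>

definition pattern_rel :: "'a set \<Rightarrow> (nat \<Rightarrow> ('a \<times> 'a) set) \<Rightarrow> pattern \<Rightarrow>
    ((nat \<times> 'a) \<times> (nat \<times> 'a)) set" where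
  "pattern_rel X V \<sigma> =
    {((j, a), (i, b)) | j a i b. \<exists>w. \<sigma> (i, j) = Some w \<and> (a, b) \<in> grp_rel X V w}"

lemma pattern_rel_iff:
  "((j, a), (i, b)) \<in> pattern_rel X V \<sigma> \<longleftrightarrow> (\<exists>w. \<sigma> (i, j) = Some w \<and> (a, b) \<in> grp_rel X V w)"
  unfolding pattern_rel_def by blast

lemma pattern_rel_Domain_iff:
  assumes "\<And>k. total_bijection X (V k)"
  shows "(j, a) \<in> Domain (pattern_rel X V \<sigma>) \<longleftrightarrow> a \<in> X \<and> (\<exists>i. \<sigma> (i, j) \<noteq> None)"
proof -
  have "(j, a) \<in> Domain (pattern_rel X V \<sigma>) \<longleftrightarrow> (\<exists>i w. \<sigma> (i, j) = Some w \<and> a \<in> Domain (grp_rel X V w))"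
    unfolding Domain_iff split_paired_Ex pattern_rel_iff by blast
  then show ?thesis
    unfolding total_bijectionD(2)[OF total_bijection_grp_rel[where V = V, OF assms]] by auto
qed

lemma pattern_rel_Range_iff:
  assumes "\<And>k. total_bijection X (V k)"
  shows "(i, b) \<in> Range (pattern_rel X V \<sigma>) \<longleftrightarrow> b \<in> X \<and> (\<exists>j. \<sigma> (i, j) \<noteq> None)"
proof -
  have "(i, b) \<in> Range (pattern_rel X V \<sigma>) \<longleftrightarrow> (\<exists>j w. \<sigma> (i, j) = Some w \<and> b \<in> Range (grp_rel X V w))"
    unfolding Range_iff split_paired_Ex pattern_rel_iff by blast
  then show ?thesis
    unfolding total_bijectionD(3)[OF total_bijection_grp_rel[where V = V, OF assms]] by auto
qed

text \<open>Symbolic evaluation is correct for every interpretation of the group variables by permutations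
  of \<open>X\<close>. Permutations are total, so the points touched by a matrix fill whole copies of \<open>X\<close>, and
  which copies these are can be seen from the pattern alone; this is why the two skew operations can be
  computed without knowing the permutations.\<close>

lemma bias_rel_pattern:
  assumes V: "\<And>k. total_bijection X (V k)" and \<pi>: "\<And>k. rook_pattern (\<pi> k)"
  shows "bias_rel (\<lambda>k. pattern_rel X V (\<pi> k)) s = pattern_rel X V (bias_pattern \<pi> s)"
proof -
  note X = total_bijectionD(4)[OF total_bijection_grp_rel[where V = V, OF V]]
  have diff: "rel_skew_diff (pattern_rel X V \<sigma>) (pattern_rel X V \<tau>) =
    pattern_rel X V (pattern_diff \<sigma> \<tau>)" (is "?L = ?R") for \<sigma> \<tau>
  proof -
    have "((j, a), (i, b)) \<in> ?L \<longleftrightarrow> ((j, a), (i, b)) \<in> ?R" for i j a b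
    proof -
      have "((j, a), (i, b)) \<in> ?L \<longleftrightarrow> (\<exists>w. \<sigma> (i, j) = Some w \<and> (a, b) \<in> grp_rel X V w) \<and>
          \<not> (a \<in> X \<and> (\<exists>i. \<tau> (i, j) \<noteq> None)) \<and> \<not> (b \<in> X \<and> (\<exists>j. \<tau> (i, j) \<noteq> None))"
        by (simp add: rel_skew_diff_def pattern_rel_Domain_iff[where V = V, OF V] pattern_rel_Range_iff[where V = V, OF V]
            pattern_rel_iff)
      also have "\<dots> \<longleftrightarrow> ((j, a), (i, b)) \<in> ?R"
      proof (cases "a \<in> X \<and> b \<in> X")
        case True
        then show ?thesis by (auto simp: pattern_rel_iff pattern_diff_Some_iff)
      next
        case False
        then have "(a, b) \<notin> grp_rel X V w" for w using X[of w] by blast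
        then show ?thesis by (simp add: pattern_rel_iff)
      qed
      finally show ?thesis .
    qed
    then show ?thesis by (auto simp: set_eq_iff)
  qed
  show ?thesis
  proof (induction s)
    case BZero show ?case by (simp add: pattern_rel_def)
  next
    case (BInv s)
    have "((j, a), (i, b)) \<in> (pattern_rel X V (bias_pattern \<pi> s))\<inverse> \<longleftrightarrow>
      ((j, a), (i, b)) \<in> pattern_rel X V (bias_pattern \<pi> (BInv s))" for i j a b
      by (auto simp: pattern_rel_iff)
    then show ?case by (auto simp: BInv set_eq_iff)
  next
    case (BMul s t)
    have "((j, a), (i, b)) \<in> pattern_rel X V (bias_pattern \<pi> t) O pattern_rel X V (bias_pattern \<pi> s)
      \<longleftrightarrow> ((j, a), (i, b)) \<in> pattern_rel X V (bias_pattern \<pi> (BMul s t))" (is "?l \<longleftrightarrow> ?r") for i j a b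
    proof -
      have "?l \<longleftrightarrow> (\<exists>k c. ((j, a), (k, c)) \<in> pattern_rel X V (bias_pattern \<pi> t) \<and>
          ((k, c), (i, b)) \<in> pattern_rel X V (bias_pattern \<pi> s))" by force
      also have "\<dots> \<longleftrightarrow> (\<exists>w. (\<exists>k x y. bias_pattern \<pi> s (i, k) = Some x \<and>
          bias_pattern \<pi> t (k, j) = Some y \<and> w = GMul x y) \<and> (a, b) \<in> grp_rel X V w)"
        unfolding pattern_rel_iff by fastforce
      also have "\<dots> \<longleftrightarrow> ?r"
        unfolding pattern_rel_iff bias_pattern.simps
          pattern_mult_Some_iff[OF rook_pattern_bias_pattern[where \<pi> = \<pi>, OF \<pi>]] ..
      finally show ?thesis .
    qed
    then show ?case by (auto simp: BMul set_eq_iff simp del: bias_pattern.simps)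
  next
    case (BDiff s t) then show ?case by (simp add: diff)
  next
    case (BAdd s t)
    have "((j, a), (i, b)) \<in> pattern_rel X V (pattern_diff (bias_pattern \<pi> s) (bias_pattern \<pi> t)) \<union>
      pattern_rel X V (bias_pattern \<pi> t) \<longleftrightarrow>
      ((j, a), (i, b)) \<in> pattern_rel X V (bias_pattern \<pi> (BAdd s t))" for i j a b
      unfolding Un_iff pattern_rel_iff bias_pattern.simps pattern_add_Some_iff by blast
    then show ?case by (auto simp: BAdd diff set_eq_iff simp del: bias_pattern.simps(6))
  qed simp
qed

text \<open>The block at \<open>(i, j)\<close> of the relation recovers the entry: it is empty exactly for the entry
  zero, since a permutation of a nonempty set is not empty.\<close>

lemma pattern_rel_eqD:
  assumes V: "\<And>k. total_bijection X (V k)" and X: "X \<noteq> {}"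
    and eq: "pattern_rel X V \<sigma> = pattern_rel X V \<tau>"
  shows "rel_option (\<lambda>p q. grp_rel X V p = grp_rel X V q) (\<sigma> (i, j)) (\<tau> (i, j))"
proof -
  define B where "B \<rho> = {(a, b). ((j, a), (i, b)) \<in> pattern_rel X V \<rho>}" for \<rho>
  have Some: "B \<rho> = grp_rel X V w" if "\<rho> (i, j) = Some w" for \<rho> w
    using that by (auto simp: B_def pattern_rel_iff)
  have None: "B \<rho> = {}" if "\<rho> (i, j) = None" for \<rho>
    using that by (auto simp: B_def pattern_rel_iff)
  have ne: "grp_rel X V w \<noteq> {}" for w
    using total_bijectionD(2)[OF total_bijection_grp_rel[where V = V, OF V], of w] X by auto
  have "B \<sigma> = B \<tau>" using eq by (simp add: B_def)
  then show ?thesis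
    by (cases "\<sigma> (i, j)"; cases "\<tau> (i, j)") (auto simp: Some None ne not_sym[OF ne] dest: Some None)
qed

text \<open>The point \<open>b\<close> of block \<open>i\<close> gets the number \<open>(i - 1) k + b\<close>, with blocks and points counted
  from 1; thus \<open>n\<close> blocks of size \<open>k\<close> fill \<open>{1..n k}\<close>.\<close>

definition flatten :: "nat \<Rightarrow> nat \<times> (nat \<times> 'g) \<Rightarrow> nat \<times> 'g" where
  "flatten k = (\<lambda>(i, (b, u)). ((i - 1) * k + b, u))"

lemma flatten_apply: "flatten k (i, (b, u)) = ((i - 1) * k + b, u)"
  by (simp add: flatten_def)

lemma block_index_unique:
  fixes i j b c k :: nat
  assumes "(i - 1) * k + b = (j - 1) * k + c" "i \<ge> 1" "j \<ge> 1" "b \<in> {1..k}" "c \<in> {1..k}"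
  shows "i = j \<and> b = c"
proof -
  have 1: "(i - 1) * k + (b - 1) = (j - 1) * k + (c - 1)" "b - 1 < k" "c - 1 < k"
    using assms by auto
  then have "i - 1 = j - 1"
    by (metis add.commute add_cancel_right_right div_less div_mult_self1 gr_implies_not0 add_0 mult.commute)
  with assms 1 show ?thesis by auto
qed

lemma inj_on_flatten: "inj_on (flatten k) ({1..n} \<times> ({1..k} \<times> A))"
proof (rule inj_onI)
  fix x y assume "x \<in> {1..n} \<times> ({1..k} \<times> A)" "y \<in> {1..n} \<times> ({1..k} \<times> A)"
    and eq: "flatten k x = flatten k y"
  then obtain i b u j c v where "x = (i, (b, u))" "y = (j, (c, v))" "i \<ge> 1" "j \<ge> 1"
    "b \<in> {1..k}" "c \<in> {1..k}" by auto
  with eq block_index_unique[of i k b j c] show "x = y" by (simp add: flatten_apply)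
qed

lemma flatten_in:
  assumes "i \<in> {1..n}" "b \<in> {1..k}" "n * k \<le> N" "u \<in> A"
  shows "flatten k (i, (b, u)) \<in> {1..N} \<times> A"
proof -
  have "(i - 1) * k + b \<le> (i - 1) * k + k" using assms by simp
  also have "\<dots> = i * k" using assms by (cases i) auto
  also have "\<dots> \<le> n * k" using assms by simp
  finally show ?thesis using assms by (simp add: flatten_apply)
qed

text \<open>Permutations from the wreath product turn the patterns into block matrices, and these lie
  inside the rook matrices of order \<open>N\<close> because \<open>n k \<le> N\<close>. The bias identity applied to them compares
  the two symbolic values block by block.\<close>

lemma (in plain_group) pattern_identities:
  assumes sat: "bias_satisfies (rook_matrices N (group0 G)) {(s, t)}"
    and k: "0 < k" "n * k \<le> N"
    and \<pi>: "\<And>l. rook_pattern (\<pi> l)"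
    and supp: "\<And>l i j w. \<pi> l (i, j) = Some w \<Longrightarrow> i \<in> {1..n} \<and> j \<in> {1..n}"
    and v: "range v \<subseteq> carrier (wreath_sym G k)"
  shows "rel_option (\<lambda>p q. group_eval (wreath_sym G k) v p = group_eval (wreath_sym G k) v q)
    (bias_pattern \<pi> s (i, j)) (bias_pattern \<pi> t (i, j))"
proof -
  define X where "X = {1..k} \<times> carrier G"
  define V where "V l = wreath_rel G k (v l)" for l
  define U where "U l = pattern_rel X V (\<pi> l)" for l
  let ?D = "{1..n} \<times> X"
  have g: "grp_rel X V w \<in> equivariant_permutations G k" for w
    using grp_rel_equivariant[OF v] by (simp add: X_def V_def[abs_def])
  have V: "total_bijection X (V l)" for l
    using wreath_rel_in[of "v l" k] v
    by (simp add: V_def X_def equivariant_permutations_def image_subset_iff)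
  have inj: "inj_on (flatten k) ?D" unfolding X_def by (rule inj_on_flatten)
  have UD: "U l \<subseteq> ?D \<times> ?D" for l
    using supp[of l] total_bijectionD(4)[OF total_bijection_grp_rel[where V = V, OF V]]
    unfolding U_def pattern_rel_def by blast
  have pbU: "partial_bijection (U l)" for l
  proof (rule partial_bijectionI)
    fix x y z assume "(x, y) \<in> U l" "(x, z) \<in> U l"
    then obtain i j a b i' c w w' where "x = (j, a)" "y = (i, b)" "z = (i', c)"
      "\<pi> l (i, j) = Some w" "(a, b) \<in> grp_rel X V w"
      "\<pi> l (i', j) = Some w'" "(a, c) \<in> grp_rel X V w'"
      unfolding U_def pattern_rel_def by blast
    then show "y = z"
      using rook_patternD(2)[OF \<pi>]
        partial_bijection_right_unique[OF total_bijectionD(1)[OF total_bijection_grp_rel[where V = V, OF V]]]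
      by (metis option.inject)
  next
    fix x y z assume "(x, z) \<in> U l" "(y, z) \<in> U l"
    then obtain i j a b j' c w w' where "x = (j, a)" "z = (i, b)" "y = (j', c)"
      "\<pi> l (i, j) = Some w" "(a, b) \<in> grp_rel X V w"
      "\<pi> l (i, j') = Some w'" "(c, b) \<in> grp_rel X V w'"
      unfolding U_def pattern_rel_def by blast
    then show "x = y"
      using rook_patternD(1)[OF \<pi>]
        partial_bijection_left_unique[OF total_bijectionD(1)[OF total_bijection_grp_rel[where V = V, OF V]]]
      by (metis option.inject)
  qed
  have "image_rel (flatten k) (U l) \<in> equivariant_bijections G {1..N}" for l
    unfolding equivariant_bijections_def
  proof (intro CollectI conjI)
    show "partial_bijection (image_rel (flatten k) (U l))"
      by (rule partial_bijection_image_rel[OF inj UD pbU])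
    have "flatten k d \<in> {1..N} \<times> carrier G" if d: "d \<in> ?D" for d
    proof -
      obtain i b u where "d = (i, (b, u))" "i \<in> {1..n}" "b \<in> {1..k}" "u \<in> carrier G"
        using d unfolding X_def by blast
      with flatten_in[OF _ _ k(2)] show ?thesis by metis
    qed
    then show "image_rel (flatten k) (U l) \<subseteq> ({1..N} \<times> carrier G) \<times> ({1..N} \<times> carrier G)"
      using UD[of l] unfolding image_rel_def by fastforce
    show "equivariant G (image_rel (flatten k) (U l))"
      unfolding equivariant_def
    proof (intro allI ballI impI)
      fix j u i u' w assume w: "w \<in> carrier G"
        and "((j, u), (i, u')) \<in> image_rel (flatten k) (U l)"
      then obtain jj b uu ii c uu' z where r: "(j, u) = flatten k (jj, (b, uu))"
        "(i, u') = flatten k (ii, (c, uu'))" "\<pi> l (ii, jj) = Some z"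
        "((b, uu), (c, uu')) \<in> grp_rel X V z"
        unfolding image_rel_iff U_def pattern_rel_def by (auto simp: X_def)
      have "equivariant G (grp_rel X V z)"
        using g by (simp add: equivariant_permutations_def equivariant_bijections_def)
      from equivariantD[OF this r(4) w] r(3)
      have "((jj, (b, uu \<otimes> w)), (ii, (c, uu' \<otimes> w))) \<in> U l" by (auto simp: U_def pattern_rel_iff)
      moreover have "(j, u \<otimes> w) = flatten k (jj, (b, uu \<otimes> w))" "(i, u' \<otimes> w) = flatten k (ii, (c, uu' \<otimes> w))"
        using r by (auto simp: flatten_apply)
      ultimately show "((j, u \<otimes> w), (i, u' \<otimes> w)) \<in> image_rel (flatten k) (U l)"
        unfolding image_rel_iff by blast
    qed
  qed
  then have "range (\<lambda>l. image_rel (flatten k) (U l)) \<subseteq> equivariant_bijections G {1..N}" by blast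
  with sat have "bias_rel (\<lambda>l. image_rel (flatten k) (U l)) s = bias_rel (\<lambda>l. image_rel (flatten k) (U l)) t"
    unfolding rook_matrices_satisfies_iff by blast
  then have "bias_rel U s = bias_rel U t"
    unfolding bias_rel_image[where V = U, OF inj UD]
    by (rule inj_on_image_rel[OF inj bias_rel_subset[where V = U, OF UD] bias_rel_subset[where V = U, OF UD]])
  then have "pattern_rel X V (bias_pattern \<pi> s) = pattern_rel X V (bias_pattern \<pi> t)"
    using bias_rel_pattern[where V = V and \<pi> = \<pi>, OF V \<pi>] by (simp add: U_def[abs_def])
  moreover have "X \<noteq> {}" using k one_closed by (auto simp: X_def)
  ultimately have "rel_option (\<lambda>p q. grp_rel X V p = grp_rel X V q)
    (bias_pattern \<pi> s (i, j)) (bias_pattern \<pi> t (i, j))"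
    by (intro pattern_rel_eqD[where V = V, OF V])
  then show ?thesis
    unfolding wreath.group_eval_eq_iff[OF v] by (simp add: X_def V_def[abs_def])
qed

text \<open>Each entry of each variable needs a group variable of its own.\<close>

definition entry_code :: "nat \<Rightarrow> nat \<Rightarrow> nat \<Rightarrow> nat" where
  "entry_code l i j = prod_encode (l, prod_encode (i, j))"

definition generic_pattern :: "nat \<Rightarrow> (nat \<Rightarrow> nat \<times> nat \<Rightarrow> 'g option) \<Rightarrow> nat \<Rightarrow> pattern" where
  "generic_pattern n v l = (\<lambda>(i, j). if i \<in> {1..n} \<and> j \<in> {1..n} \<and> v l (i, j) \<noteq> None
    then Some (GVar (entry_code l i j)) else None)"

lemma generic_pattern_Some_iff:
  "generic_pattern n v l (i, j) = Some w \<longleftrightarrow>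
    i \<in> {1..n} \<and> j \<in> {1..n} \<and> v l (i, j) \<noteq> None \<and> w = GVar (entry_code l i j)"
  by (auto simp: generic_pattern_def)

text \<open>Every valuation in rook matrices is an instance of the symbolic one: its support is the pattern,
  and its nonzero entries are the values of the group variables.\<close>

lemma (in plain_group) rook_satisfies_from_patterns:
  assumes "\<And>\<pi> i j u. \<lbrakk>\<And>l. rook_pattern (\<pi> l);
      \<And>l i j w. \<pi> l (i, j) = Some w \<Longrightarrow> i \<in> {1..n} \<and> j \<in> {1..n}; range u \<subseteq> carrier G\<rbrakk>
      \<Longrightarrow> rel_option (\<lambda>p q. group_eval G u p = group_eval G u q)
        (bias_pattern \<pi> s (i, j)) (bias_pattern \<pi> t (i, j))"
  shows "bias_satisfies (rook_matrices n (group0 G)) {(s, t)}"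
proof -
  interpret T: permutation_representation G "carrier G" "translation_rel G"
    by (rule translation_representation)
  have "bias_rel U s = bias_rel U t" if U: "range U \<subseteq> equivariant_bijections G {1..n}" for U
  proof -
    have "\<forall>l. \<exists>x \<in> carrier (rook_matrices n (group0 G)). U l = rook_rel G n x"
      using U rook_rel_surj by blast
    then obtain x where x: "\<And>l. x l \<in> carrier (rook_matrices n (group0 G))"
      and Ux: "\<And>l. U l = rook_rel G n (x l)" by metis
    define u where "u m = (case prod_decode m of (l, q) \<Rightarrow> case prod_decode q of (i, j) \<Rightarrow>
      if i \<in> {1..n} \<and> j \<in> {1..n} \<and> x l (i, j) \<noteq> None then the (x l (i, j)) else \<one>)" for m
    have u: "range u \<subseteq> carrier G"
      using rook_entry[OF x] by (auto simp: u_def split: prod.splits)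
    have ue: "u (entry_code l i j) = h" if "x l (i, j) = Some h" "i \<in> {1..n}" "j \<in> {1..n}" for l i j h
      using that by (simp add: u_def entry_code_def)
    let ?\<pi> = "generic_pattern n x" and ?V = "\<lambda>m. translation_rel G (u m)"
    have \<pi>: "rook_pattern (?\<pi> l)" for l
      by (rule rook_patternI; unfold generic_pattern_Some_iff)
        (metis not_None_eq rook_row_unique[OF x] rook_col_unique[OF x])+
    have V: "total_bijection (carrier G) (?V m)" for m
      using u T.total_rep by blast
    have "U l = pattern_rel (carrier G) ?V (?\<pi> l)" for l
    proof -
      have "((j, a), (i, b)) \<in> U l \<longleftrightarrow> ((j, a), (i, b)) \<in> pattern_rel (carrier G) ?V (?\<pi> l)" for i j a b
        unfolding Ux rook_rel_iff pattern_rel_iff generic_pattern_Some_iff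
        by (auto simp: translation_rel_def ue)
      then show ?thesis by (auto simp: set_eq_iff)
    qed
    then have "U = (\<lambda>l. pattern_rel (carrier G) ?V (?\<pi> l))" by (rule ext)
    then have Upat: "bias_rel U r = pattern_rel (carrier G) ?V (bias_pattern ?\<pi> r)" for r
      using bias_rel_pattern[where V = ?V and \<pi> = ?\<pi>, OF V \<pi>, of r] by simp
    have r: "rel_option (\<lambda>p q. grp_rel (carrier G) ?V p = grp_rel (carrier G) ?V q)
      (bias_pattern ?\<pi> s (i, j)) (bias_pattern ?\<pi> t (i, j))" for i j
      unfolding T.group_eval_eq_iff[OF u, symmetric]
      by (rule assms[OF \<pi> _ u]) (simp add: generic_pattern_Some_iff)
    have "((j, a), (i, b)) \<in> bias_rel U s \<longleftrightarrow> ((j, a), (i, b)) \<in> bias_rel U t" for i j a b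
      unfolding Upat pattern_rel_iff using r[of i j] by (auto simp: option_rel_Some1 option_rel_Some2)
    then show ?thesis by (auto simp: set_eq_iff)
  qed
  then show ?thesis unfolding rook_matrices_satisfies_iff by blast
qed

section \<open>Corner terms\<close>

lemma partial_bijection_bias_rel:
  assumes "\<And>k. partial_bijection (V k)"
  shows "partial_bijection (bias_rel V s)"
proof (induction s)
  case BZero show ?case by (simp add: partial_bijection_def)
next
  case (BAdd s t)
  have "Domain (rel_skew_diff R Q) \<inter> Domain Q = {}" "Range (rel_skew_diff R Q) \<inter> Range Q = {}"
    for R Q :: "('a \<times> 'a) set"
    unfolding rel_skew_diff_def by blast+
  with BAdd show ?case by (simp add: partial_bijection_Un partial_bijection_skew_diff)
qed (simp_all add: assms partial_bijection_converse partial_bijection_relcomp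
    partial_bijection_skew_diff)

definition dom_term :: "bias_term \<Rightarrow> bias_term" where
  "dom_term s = BMul (BInv s) s"

definition rng_term :: "bias_term \<Rightarrow> bias_term" where
  "rng_term s = BMul s (BInv s)"

text \<open>Variable 0 is the shift \<open>a\<close>. Variable 1 contributes only its domain: it makes \<open>a\<^sup>0\<close> available,
  which is needed for \<open>n = 1\<close>, although a bias has no identity element. The variables from 2 on stand
  for the group variables.\<close>

primrec shift_power :: "nat \<Rightarrow> bias_term" where
  "shift_power 0 = dom_term (BVar 1)"
| "shift_power (Suc m) = BMul (BVar 0) (shift_power m)"

text \<open>The points where \<open>a\<^sup>n\<^sup>-\<^sup>1\<close> is defined and that are not in the range of \<open>a\<close>.\<close>

definition seed_term :: "nat \<Rightarrow> bias_term" where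
  "seed_term n = BDiff (dom_term (shift_power (n - 1))) (rng_term (BVar 0))"

text \<open>One round of shrinking: for idempotent \<open>e\<close>, the domain of \<open>e \<cdot> x\<close> consists of the points that
  \<open>x\<close> sends into \<open>e\<close>. All \<open>r\<close> variables are tested against the same \<open>e\<close>, so that a round that changes
  nothing shows stability under all of them.\<close>

primrec shrink_term :: "nat \<Rightarrow> bias_term \<Rightarrow> bias_term" where
  "shrink_term 0 e = e"
| "shrink_term (Suc l) e = BMul (shrink_term l e)
    (BMul (dom_term (BMul e (BVar (l + 2)))) (dom_term (BMul e (BInv (BVar (l + 2))))))"

primrec corner_term :: "nat \<Rightarrow> nat \<Rightarrow> nat \<Rightarrow> bias_term" where
  "corner_term r n 0 = seed_term n"
| "corner_term r n (Suc t) = shrink_term r (corner_term r n t)"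

text \<open>The variables are cut down to the corner of \<open>e\<close>, and \<open>e\<close> takes the place of the neutral
  element.\<close>

primrec relativize :: "bias_term \<Rightarrow> group_term \<Rightarrow> bias_term" where
  "relativize e (GVar k) = BMul (BVar (k + 2)) e"
| "relativize e GOne = e"
| "relativize e (GInv s) = BInv (relativize e s)"
| "relativize e (GMul s t) = BMul (relativize e s) (relativize e t)"

definition seed_set :: "(nat \<Rightarrow> ('a \<times> 'a) set) \<Rightarrow> nat \<Rightarrow> 'a set" where
  "seed_set V n = Domain (Id_on (Domain (V 1)) O V 0 ^^ (n - 1)) - Range (V 0)"

definition shrink :: "(nat \<Rightarrow> ('a \<times> 'a) set) \<Rightarrow> nat \<Rightarrow> 'a set \<Rightarrow> 'a set" where
  "shrink V r A = {p \<in> A. \<forall>l < r. (\<exists>q \<in> A. (p, q) \<in> V (l + 2)) \<and> (\<exists>q \<in> A. (q, p) \<in> V (l + 2))}"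

context
  fixes V :: "nat \<Rightarrow> ('a \<times> 'a) set"
  assumes V: "\<And>k. partial_bijection (V k)"
begin

lemma bias_rel_dom_term: "bias_rel V (dom_term s) = Id_on (Domain (bias_rel V s))"
  unfolding dom_term_def
  by (simp add: partial_bijection_dom partial_bijection_bias_rel[where V = V, OF V])

lemma bias_rel_rng_term: "bias_rel V (rng_term s) = Id_on (Range (bias_rel V s))"
  unfolding rng_term_def
  by (simp add: partial_bijection_ran partial_bijection_bias_rel[where V = V, OF V])

lemma bias_rel_shift_power: "bias_rel V (shift_power m) = Id_on (Domain (V 1)) O V 0 ^^ m"
  by (induction m) (simp_all add: bias_rel_dom_term O_assoc)

lemma bias_rel_seed_term: "bias_rel V (seed_term n) = Id_on (seed_set V n)"
  unfolding seed_term_def seed_set_def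
  by (auto simp: bias_rel_dom_term bias_rel_rng_term bias_rel_shift_power rel_skew_diff_def)

lemma bias_rel_shrink_term:
  assumes e: "bias_rel V e = Id_on A"
  shows "bias_rel V (shrink_term r e) = Id_on (shrink V r A)"
proof (induction r)
  case 0 show ?case by (simp add: e shrink_def)
next
  case (Suc l)
  have 1: "bias_rel V (dom_term (BMul e (BVar (l + 2)))) = Id_on {p. \<exists>q \<in> A. (p, q) \<in> V (l + 2)}"
    unfolding bias_rel_dom_term by (auto simp: e)
  have 2: "bias_rel V (dom_term (BMul e (BInv (BVar (l + 2))))) = Id_on {p. \<exists>q \<in> A. (q, p) \<in> V (l + 2)}"
    unfolding bias_rel_dom_term by (auto simp: e)
  have "bias_rel V (shrink_term (Suc l) e) = (Id_on {p. \<exists>q \<in> A. (q, p) \<in> V (l + 2)} O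
      Id_on {p. \<exists>q \<in> A. (p, q) \<in> V (l + 2)}) O Id_on (shrink V l A)"
    by (simp only: shrink_term.simps bias_rel.simps Suc 1 2)
  also have "\<dots> = Id_on (shrink V (Suc l) A)"
    unfolding shrink_def less_Suc_eq by blast
  finally show ?case .
qed

lemma bias_rel_corner_term: "bias_rel V (corner_term r n t) = Id_on ((shrink V r ^^ t) (seed_set V n))"
  by (induction t) (simp_all add: bias_rel_seed_term bias_rel_shrink_term)

end

primrec var_bound :: "group_term \<Rightarrow> nat" where
  "var_bound (GVar k) = Suc k"
| "var_bound GOne = 0"
| "var_bound (GInv s) = var_bound s"
| "var_bound (GMul s t) = max (var_bound s) (var_bound t)"

text \<open>Variables from \<open>r\<close> on do not occur in the terms considered; the default \<open>Id_on A\<close> makes every value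
  a permutation of \<open>A\<close>.\<close>

definition corner_perm :: "(nat \<Rightarrow> ('a \<times> 'a) set) \<Rightarrow> nat \<Rightarrow> 'a set \<Rightarrow> nat \<Rightarrow> ('a \<times> 'a) set" where
  "corner_perm V r A k = (if k < r then V (k + 2) \<inter> A \<times> A else Id_on A)"

text \<open>If \<open>q\<close> lies in \<open>A\<close>, then stability provides a preimage of \<open>q\<close> in \<open>A\<close>, and by injectivity this
  preimage is \<open>p\<close>; the other implication is symmetric.\<close>

lemma stable_step:
  assumes V: "partial_bijection (V (k + 2))" and st: "shrink V r A = A" and k: "k < r"
    and pq: "(p, q) \<in> V (k + 2)"
  shows "p \<in> A \<longleftrightarrow> q \<in> A"
proof -
  have *: "\<exists>q \<in> A. (p, q) \<in> V (k + 2)" "\<exists>q \<in> A. (q, p) \<in> V (k + 2)" if "p \<in> A" for p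
    using that k st unfolding shrink_def by blast+
  show ?thesis
    using *[of p] *[of q] pq V by (metis partial_bijection_unique)
qed

lemma total_bijection_corner_perm:
  assumes V: "\<And>k. partial_bijection (V k)" and st: "shrink V r A = A"
  shows "total_bijection A (corner_perm V r A k)"
proof (cases "k < r")
  case True
  have *: "\<exists>q \<in> A. (p, q) \<in> V (k + 2)" "\<exists>q \<in> A. (q, p) \<in> V (k + 2)" if "p \<in> A" for p
    using that True st unfolding shrink_def by blast+
  have "partial_bijection (V (k + 2) \<inter> A \<times> A)"
    using V[of "k + 2"] unfolding partial_bijection_def single_valued_def by blast
  moreover have "Domain (V (k + 2) \<inter> A \<times> A) = A" "Range (V (k + 2) \<inter> A \<times> A) = A"
    using * by blast+
  ultimately show ?thesis using True by (simp add: total_bijection_def corner_perm_def)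
qed (simp add: corner_perm_def total_bijection_Id_on)

text \<open>On a stable set the variables act as permutations, so the bias operations that imitate a group
  term compute the group operations.\<close>

lemma bias_rel_relativize:
  assumes V: "\<And>k. partial_bijection (V k)" and e: "bias_rel V e = Id_on A"
    and st: "shrink V r A = A" and t: "var_bound t \<le> r"
  shows "bias_rel V (relativize e t) = grp_rel A (corner_perm V r A) t"
  using t
proof (induction t)
  case (GVar k)
  then have k: "k < r" by simp
  have "Id_on A O V (k + 2) = V (k + 2) \<inter> A \<times> A"
    using stable_step[OF V st k] by blast
  with k show ?case by (simp add: e corner_perm_def)
qed (simp_all add: e)

lemma shrink_subset: "shrink V r A \<subseteq> A"
  unfolding shrink_def by blast

lemma grp_rel_image:
  assumes f: "inj_on f A" and V: "\<And>k. V k \<subseteq> A \<times> A"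
  shows "grp_rel (f ` A) (\<lambda>k. image_rel f (V k)) t = image_rel f (grp_rel A V t)"
proof (induction t)
  case (GMul s t)
  have "grp_rel A V t \<subseteq> A \<times> A" for t by (induction t) (use V in \<open>force+\<close>)
  then show ?case using GMul by (simp add: image_rel_relcomp[OF f])
qed (simp_all add: image_rel_Id_on image_rel_converse)

lemma grp_rel_Un_Id_on:
  assumes V: "\<And>k. V k \<subseteq> A \<times> A" and disj: "A \<inter> B = {}"
  shows "grp_rel (A \<union> B) (\<lambda>k. V k \<union> Id_on B) t = grp_rel A V t \<union> Id_on B"
proof (induction t)
  case (GMul s t)
  have "grp_rel A V t \<subseteq> A \<times> A" for t by (induction t) (use V in \<open>force+\<close>)
  then have "(grp_rel A V t \<union> Id_on B) O (grp_rel A V s \<union> Id_on B) =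
      grp_rel A V t O grp_rel A V s \<union> Id_on B"
    using disj by blast
  with GMul show ?case by simp
qed auto

text \<open>The iterates may be infinite, so their decrease is measured through \<open>g\<close>, whose values are subsets
  of a finite set. A strictly decreasing chain has at most \<open>card B\<close> steps, and once a step changes
  nothing, no later one does.\<close>

lemma decreasing_iterates_stabilize:
  fixes F :: "'a set \<Rightarrow> 'a set"
  assumes bound: "\<And>t. g ((F ^^ t) A) \<subseteq> B" and B: "finite B" "card B \<le> t"
    and strict: "\<And>s. (F ^^ Suc s) A \<noteq> (F ^^ s) A \<Longrightarrow> g ((F ^^ Suc s) A) \<subset> g ((F ^^ s) A)"
  shows "F ((F ^^ t) A) = (F ^^ t) A"
proof -
  have "\<exists>s \<le> t. (F ^^ Suc s) A = (F ^^ s) A"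
  proof (rule ccontr)
    assume "\<not> ?thesis"
    then have st: "g ((F ^^ Suc s) A) \<subset> g ((F ^^ s) A)" if "s \<le> t" for s using that strict by blast
    have "card (g ((F ^^ s) A)) + s \<le> card B" if "s \<le> Suc t" for s
      using that
    proof (induction s)
      case 0 show ?case using bound[of 0] B by (simp add: card_mono)
    next
      case (Suc s)
      have "card (g ((F ^^ Suc s) A)) < card (g ((F ^^ s) A))"
        using st[of s] Suc.prems finite_subset[OF bound B(1)] by (intro psubset_card_mono) auto
      with Suc show ?case by linarith
    qed
    from this[of "Suc t"] B show False by simp
  qed
  then obtain s where s: "s \<le> t" "F ((F ^^ s) A) = (F ^^ s) A" by auto
  have "(F ^^ (s + d)) A = (F ^^ s) A" for d by (induction d) (simp_all add: s)
  from this[of "t - s"] s show ?thesis by simp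
qed

context plain_group
begin

lemma equivariant_relcomp:
  "\<lbrakk>equivariant G R; equivariant G Q\<rbrakk> \<Longrightarrow> equivariant G (R O Q)"
  unfolding equivariant_def by (fastforce simp: relcomp_unfold)

lemma relpow_shift:
  assumes R: "R \<in> equivariant_bijections G J"
  shows "partial_bijection (R ^^ m)" "equivariant G (R ^^ m)"
proof (induction m)
  case 0
  { case 1 show ?case by (simp add: partial_bijection_def single_valued_def) }
  { case 2 show ?case by (auto simp: equivariant_def) }
next
  case (Suc m)
  { case 1 show ?case using Suc equivariant_bijectionsD(1)[OF R] by (simp add: partial_bijection_relcomp) }
  { case 2 show ?case using Suc equivariant_bijectionsD(2)[OF R] by (simp add: equivariant_relcomp) }
qed

lemma relpow_subset:
  assumes "R \<subseteq> A \<times> A" "x \<in> A" "(x, y) \<in> R ^^ m"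
  shows "y \<in> A"
  using assms(3,1,2) by (induction m arbitrary: y) auto

section \<open>A group identity holds in every corner of large rook matrices\<close>

text \<open>The pairs of \<open>j\<close> in \<open>T\<close> and \<open>i < n\<close> are mapped to the first component of \<open>a\<^sup>i(j, \<one>)\<close>, and this map
  into \<open>{1..N}\<close> is injective: if \<open>a\<^sup>i(j, \<one>)\<close> and \<open>a\<^sup>i\<^sup>'(j', \<one>)\<close> agree up to their labels, where
  \<open>i < i'\<close>, then a translation and cancellation of \<open>a\<^sup>i\<close> put \<open>(j, \<one>)\<close> into the range of \<open>a\<close>, which the
  seed set avoids.\<close>

lemma card_seed_set:
  assumes R: "V 0 \<in> equivariant_bijections G {1..N}"
    and T: "\<And>j. j \<in> T \<Longrightarrow> j \<in> {1..N} \<and> (j, \<one>) \<in> seed_set V n"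
  shows "card T * n \<le> N"
proof -
  let ?R = "V 0"
  note pb = relpow_shift(1)[OF R] and eqv = relpow_shift(2)[OF R]
  have ex: "\<exists>y. y \<in> {1..N} \<times> carrier G \<and> ((j, \<one>), y) \<in> ?R ^^ i" if "j \<in> T" "i < n" for i j
  proof -
    have "(j, \<one>) \<in> Domain (?R ^^ (n - 1))" using T[OF that(1)] unfolding seed_set_def by blast
    moreover have "n - 1 = i + (n - 1 - i)" using that(2) by simp
    ultimately obtain z where "((j, \<one>), z) \<in> ?R ^^ (i + (n - 1 - i))" by (metis DomainE)
    then obtain y where y: "((j, \<one>), y) \<in> ?R ^^ i" unfolding relpow_add by blast
    have "y \<in> {1..N} \<times> carrier G"
      using T[OF that(1)] by (intro relpow_subset[OF equivariant_bijectionsD(3)[OF R] _ y]) auto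
    with y show ?thesis by blast
  qed
  define d where "d i j = (SOME y. y \<in> {1..N} \<times> carrier G \<and> ((j, \<one>), y) \<in> ?R ^^ i)" for i j
  define c where "c i j = fst (d i j)" for i j
  define h where "h i j = snd (d i j)" for i j
  have c: "h i j \<in> carrier G \<and> c i j \<in> {1..N} \<and> ((j, \<one>), (c i j, h i j)) \<in> ?R ^^ i"
    if "j \<in> T" "i < n" for i j
    using someI_ex[OF ex[OF that]] unfolding d_def[symmetric] by (auto simp: c_def h_def mem_Times_iff)
  have key: "i' = i \<and> j' = j" if a: "j \<in> T" "j' \<in> T" "i < n" "i' < n" "i \<le> i'" "c i j = c i' j'"
    for i j i' j'
  proof -
    \<comment> \<open>Right multiplication by this element makes the label of the second point equal to that of the first.\<close>
    let ?w = "inv (h i' j') \<otimes> h i j"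
    have h: "h i j \<in> carrier G" "h i' j' \<in> carrier G" using c a by blast+
    have "((j', \<one> \<otimes> ?w), (c i' j', h i' j' \<otimes> ?w)) \<in> ?R ^^ i'"
      using c[OF a(2,4)] h by (intro equivariantD[OF eqv]) auto
    then have "((j', ?w), (c i j, h i j)) \<in> ?R ^^ ((i' - i) + i)"
      using a h by (simp add: m_assoc[symmetric])
    then obtain y where y: "((j', ?w), y) \<in> ?R ^^ (i' - i)" "(y, (c i j, h i j)) \<in> ?R ^^ i"
      unfolding relpow_add by blast
    have "y = (j, \<one>)" using c[OF a(1,3)] y(2) partial_bijection_left_unique[OF pb] by blast
    with y have y: "((j', ?w), (j, \<one>)) \<in> ?R ^^ (i' - i)" by simp
    have "i' - i = 0"
    proof (rule ccontr)
      assume "i' - i \<noteq> 0"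
      then obtain m where "i' - i = Suc m" using not0_implies_Suc by blast
      with y have "(j, \<one>) \<in> Range ?R" by auto
      with T[OF a(1)] show False unfolding seed_set_def by blast
    qed
    with y a show ?thesis by simp
  qed
  have "inj_on (\<lambda>(j, i). c i j) (T \<times> {..<n})"
  proof (rule inj_onI)
    fix x y assume "x \<in> T \<times> {..<n}" "y \<in> T \<times> {..<n}"
      and eq: "(\<lambda>(j, i). c i j) x = (\<lambda>(j, i). c i j) y"
    then obtain i j i' j' where r: "x = (j, i)" "y = (j', i')" "j \<in> T" "j' \<in> T" "i < n" "i' < n" by auto
    with eq have eq: "c i j = c i' j'" by simp
    show "x = y"
      using key[OF r(3,4,5,6) _ eq] key[OF r(4,3,6,5) _ eq[symmetric]] r(1,2)
      by (cases "i \<le> i'") auto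
  qed
  moreover have "(\<lambda>(j, i). c i j) ` (T \<times> {..<n}) \<subseteq> {1..N}" using c by auto
  ultimately have "card (T \<times> {..<n}) \<le> card {1..N}" by (rule card_inj_on_le) simp
  then show ?thesis by (simp add: card_cartesian_product)
qed

lemma equivariant_diagonal:
  assumes "Id_on A \<in> equivariant_bijections G J"
  shows "A = {j. (j, \<one>) \<in> A} \<times> carrier G"
proof -
  have sub: "A \<subseteq> J \<times> carrier G" using equivariant_bijectionsD(3)[OF assms] by auto
  have *: "(j, u) \<in> A \<longleftrightarrow> u \<in> carrier G \<and> (j, \<one>) \<in> A" for j u
  proof
    assume a: "(j, u) \<in> A"
    then have u: "u \<in> carrier G" using sub by auto
    from a u equivariantD[OF equivariant_bijectionsD(2)[OF assms], of j u j u "inv u"]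
    show "u \<in> carrier G \<and> (j, \<one>) \<in> A" by auto
  next
    assume a: "u \<in> carrier G \<and> (j, \<one>) \<in> A"
    with equivariantD[OF equivariant_bijectionsD(2)[OF assms], of j \<one> j \<one> u]
    show "(j, u) \<in> A" by auto
  qed
  show ?thesis
  proof (rule Set.set_eqI)
    fix x :: "nat \<times> 'g" obtain j u where "x = (j, u)" by (cases x)
    then show "x \<in> A \<longleftrightarrow> x \<in> {j. (j, \<one>) \<in> A} \<times> carrier G" using *[of j u] by auto
  qed
qed

text \<open>A set of at most \<open>k\<close> rows can be renumbered into \<open>{1..k}\<close>, and permutations of it extend by the
  identity to all of \<open>{1..k} \<times> G\<close>, where the identities of the wreath product apply.\<close>

lemma wreath_identity_on_corner:
  assumes sat: "group_satisfies (wreath_sym G k) {(p, q)}"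
    and T: "finite T" "card T \<le> k"
    and V: "\<And>l. total_bijection (T \<times> carrier G) (V l)" "\<And>l. equivariant G (V l)"
  shows "grp_rel (T \<times> carrier G) V p = grp_rel (T \<times> carrier G) V q"
proof -
  obtain \<beta> where \<beta>: "inj_on \<beta> T" "\<beta> ` T \<subseteq> {1..k}"
    using card_le_inj[OF T(1), of "{1..k}"] T(2) by auto
  define f where "f = (\<lambda>(j, u :: 'g). (\<beta> j, u))"
  let ?A = "T \<times> carrier G" and ?B = "({1..k} - \<beta> ` T) \<times> carrier G"
  have f: "inj_on f ?A" using \<beta>(1) by (auto simp: f_def inj_on_def)
  have fA: "f ` ?A = \<beta> ` T \<times> carrier G" by (force simp: f_def)
  have X: "f ` ?A \<union> ?B = {1..k} \<times> carrier G" using \<beta>(2) unfolding fA by blast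
  have disj: "f ` ?A \<inter> ?B = {}" unfolding fA by blast
  note VA = total_bijectionD(4)[OF V(1)]
  define W where "W l = image_rel f (V l) \<union> Id_on ?B" for l
  have fV: "image_rel f (V l) \<subseteq> f ` ?A \<times> f ` ?A" for l
    using VA[of l] unfolding image_rel_def by fastforce
  have W: "W l \<in> equivariant_permutations G k" for l
  proof -
    have DR: "Domain (image_rel f (V l)) = f ` ?A" "Range (image_rel f (V l)) = f ` ?A"
      using total_bijectionD(2,3)[OF V(1)[of l]] by (simp_all add: Domain_image_rel Range_image_rel)
    have "partial_bijection (W l)"
      unfolding W_def
      by (rule partial_bijection_Un[OF partial_bijection_image_rel[OF f VA total_bijectionD(1)[OF V(1)]]
            total_bijectionD(1)[OF total_bijection_Id_on]])
        (simp_all only: DR Domain_Id_on Range_Id_on disj)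
    moreover have "Domain (W l) = {1..k} \<times> carrier G" "Range (W l) = {1..k} \<times> carrier G"
      unfolding W_def Domain_Un_eq Range_Un_eq DR X[symmetric] by auto
    moreover have "equivariant G (W l)"
      unfolding equivariant_def
    proof (intro allI ballI impI)
      fix j u i v w assume w: "w \<in> carrier G" and "((j, u), (i, v)) \<in> W l"
      then consider (img) "((j, u), (i, v)) \<in> image_rel f (V l)"
        | (id) "(j, u) = (i, v)" "(j, u) \<in> ?B" unfolding W_def by auto
      then show "((j, u \<otimes> w), (i, v \<otimes> w)) \<in> W l"
      proof cases
        case img
        then obtain jj ii where "j = \<beta> jj" "i = \<beta> ii" "((jj, u), (ii, v)) \<in> V l"
          unfolding image_rel_iff f_def by auto
        with equivariantD[OF V(2) this(3) w] have "((j, u \<otimes> w), (i, v \<otimes> w)) \<in> image_rel f (V l)"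
          unfolding image_rel_iff by (metis f_def split_conv)
        then show ?thesis unfolding W_def by blast
      next
        case id
        with w show ?thesis unfolding W_def by auto
      qed
    qed
    moreover have "W l \<subseteq> ({1..k} \<times> carrier G) \<times> ({1..k} \<times> carrier G)"
      using fV[of l] unfolding W_def X[symmetric] by auto
    ultimately show ?thesis
      by (simp add: equivariant_permutations_def equivariant_bijections_def total_bijection_def)
  qed
  have *: "grp_rel ({1..k} \<times> carrier G) W t = image_rel f (grp_rel ?A V t) \<union> Id_on ?B" for t
    unfolding X[symmetric] W_def grp_rel_Un_Id_on[OF fV disj] grp_rel_image[OF f VA] ..
  have sub: "grp_rel ?A V t \<subseteq> ?A \<times> ?A" for t
    by (rule total_bijectionD(4)[OF total_bijection_grp_rel[where V = V, OF V(1)]])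
  have img: "image_rel f (grp_rel ?A V t) \<subseteq> f ` ?A \<times> f ` ?A" for t
    using sub[of t] unfolding image_rel_def by fastforce
  have "range W \<subseteq> equivariant_permutations G k" using W by blast
  from wreath_identity[OF sat this]
  have "image_rel f (grp_rel ?A V p) \<union> Id_on ?B = image_rel f (grp_rel ?A V q) \<union> Id_on ?B"
    unfolding * .
  then have "image_rel f (grp_rel ?A V p) = image_rel f (grp_rel ?A V q)"
    using img[of p] img[of q] disj by blast
  then show ?thesis by (rule inj_on_image_rel[OF f sub sub])
qed

text \<open>The corner is empty if \<open>N < n\<close>, and then both sides vanish; this is why the wreath product is
  assumed to satisfy the identity only for \<open>n \<le> N\<close>.\<close>

lemma corner_identity_holds:
  assumes sat: "n \<le> N \<Longrightarrow> group_satisfies (wreath_sym G (N div n)) {(p, q)}"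
    and n: "0 < n" and r: "var_bound p \<le> r" "var_bound q \<le> r" and t: "N \<le> t"
  shows "bias_satisfies (rook_matrices N (group0 G))
    {(relativize (corner_term r n t) p, relativize (corner_term r n t) q)}"
proof -
  have "bias_rel V (relativize (corner_term r n t) p) = bias_rel V (relativize (corner_term r n t) q)"
    if V: "range V \<subseteq> equivariant_bijections G {1..N}" for V
  proof -
    have Vk: "V k \<in> equivariant_bijections G {1..N}" for k using V by blast
    note pb = equivariant_bijectionsD(1)[OF Vk]
    define A where "A s = (shrink V r ^^ s) (seed_set V n)" for s
    define T where "T B = {j. (j, \<one>) \<in> B}" for B :: "(nat \<times> 'g) set"
    have c: "bias_rel V (corner_term r n s) = Id_on (A s)" for s
      unfolding A_def by (rule bias_rel_corner_term[OF pb])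
    then have I: "Id_on (A s) \<in> equivariant_bijections G {1..N}" for s
      using bias_rel_equivariant[OF V] by metis
    then have AT: "A s = T (A s) \<times> carrier G" for s
      unfolding T_def by (rule equivariant_diagonal)
    have TN: "T (A s) \<subseteq> {1..N}" for s
      using equivariant_bijectionsD(3)[OF I[of s]] unfolding T_def by auto
    have stable: "shrink V r (A t) = A t"
      unfolding A_def
    proof (rule decreasing_iterates_stabilize[where g = T and B = "{1..N}"])
      show "T ((shrink V r ^^ Suc s) (seed_set V n)) \<subset> T ((shrink V r ^^ s) (seed_set V n))"
        if "(shrink V r ^^ Suc s) (seed_set V n) \<noteq> (shrink V r ^^ s) (seed_set V n)" for s
      proof -
        have "A (Suc s) \<subseteq> A s" by (simp add: A_def shrink_subset)
        then have "T (A (Suc s)) \<subseteq> T (A s)" unfolding T_def by blast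
        moreover have "T (A (Suc s)) \<noteq> T (A s)" using that AT unfolding A_def[symmetric] by metis
        ultimately show ?thesis unfolding A_def by blast
      qed
    qed (use TN t in \<open>auto simp: A_def\<close>)
    let ?P = "corner_perm V r (A t)"
    have tb: "total_bijection (A t) (?P l)" for l
      by (rule total_bijection_corner_perm[OF pb stable])
    have eqv: "equivariant G (?P l)" for l
    proof -
      have "equivariant G (Id_on (A t))" using equivariant_bijectionsD(2)[OF I] .
      moreover have "equivariant G (V (l + 2) \<inter> A t \<times> A t)"
        using equivariant_bijectionsD(2)[OF Vk, of "l + 2"] AT[of t] unfolding equivariant_def
        by (smt (verit) IntE IntI SigmaE SigmaI m_closed prod.inject)
      ultimately show ?thesis by (simp add: corner_perm_def)
    qed
    have "A s \<subseteq> seed_set V n" for s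
      unfolding A_def by (induction s) (use shrink_subset in \<open>fastforce+\<close>)
    then have card: "card (T (A t)) * n \<le> N"
      using TN[of t] unfolding T_def by (intro card_seed_set[where V = V and N = N and n = n, OF Vk]) blast
    have "grp_rel (A t) ?P p = grp_rel (A t) ?P q"
    proof (cases "n \<le> N")
      case True
      have "card (T (A t)) \<le> N div n" using card n by (simp add: less_eq_div_iff_mult_less_eq)
      moreover have "finite (T (A t))" using TN finite_subset by blast
      ultimately show ?thesis
        using wreath_identity_on_corner[OF sat[OF True], of "T (A t)" ?P] tb eqv AT[of t] by simp
    next
      case False
      then have "card (T (A t)) = 0" using card n by (cases "card (T (A t))") auto
      moreover have "finite (T (A t))" using TN finite_subset by blast
      ultimately have "A t = {}" using AT[of t] by simp
      then show ?thesis
        using total_bijectionD(4)[OF total_bijection_grp_rel[where V = ?P, OF tb]] by blast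
    qed
    then show ?thesis
      unfolding bias_rel_relativize[OF pb c stable r(1)] bias_rel_relativize[OF pb c stable r(2)] .
  qed
  then show ?thesis unfolding rook_matrices_satisfies_iff by blast
qed

end

section \<open>A group identity can be read off from a corner\<close>

lemma group_eval_cong:
  "(\<And>k. k < var_bound t \<Longrightarrow> v k = w k) \<Longrightarrow> group_eval G v t = group_eval G w t"
  by (induction t) auto

text \<open>The valuation with corner \<open>{1} \<times> G\<close>: the shift \<open>1 \<mapsto> 2 \<mapsto> \<dots> \<mapsto> n\<close>, the identity, and the
  elements \<open>g\<^sub>0, g\<^sub>1, \<dots>\<close> placed at position \<open>(1, 1)\<close>.\<close>

definition corner_valuation :: "'g monoid \<Rightarrow> nat \<Rightarrow> (nat \<Rightarrow> 'g) \<Rightarrow> nat \<Rightarrow>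
    ((nat \<times> 'g) \<times> (nat \<times> 'g)) set" where
  "corner_valuation G n g k = (case k of
      0 \<Rightarrow> {((j, u), (Suc j, u)) | j u. 1 \<le> j \<and> Suc j \<le> n \<and> u \<in> carrier G}
    | Suc 0 \<Rightarrow> Id_on ({1..n} \<times> carrier G)
    | Suc (Suc l) \<Rightarrow> image_rel (Pair 1) (translation_rel G (g l)))"

lemma corner_valuation_simps:
  "corner_valuation G n g 0 = {((j, u), (Suc j, u)) | j u. 1 \<le> j \<and> Suc j \<le> n \<and> u \<in> carrier G}"
  "corner_valuation G n g 1 = Id_on ({1..n} \<times> carrier G)"
  "corner_valuation G n g (l + 2) = image_rel (Pair 1) (translation_rel G (g l))"
  by (simp_all add: corner_valuation_def)

context plain_group
begin

lemma corner_valuation_equivariant: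
  assumes n: "0 < n" and g: "range g \<subseteq> carrier G"
  shows "corner_valuation G n g k \<in> equivariant_bijections G {1..n}"
proof -
  interpret T: permutation_representation G "carrier G" "translation_rel G"
    by (rule translation_representation)
  consider "k = 0" | "k = 1" | l where "k = l + 2"
    by (metis One_nat_def Suc_1 add_2_eq_Suc' not0_implies_Suc)
  then show ?thesis
  proof cases
    case 1
    show ?thesis
      unfolding 1 corner_valuation_simps equivariant_bijections_def
      by (auto simp: equivariant_def intro!: partial_bijectionI)
  next
    case 2
    show ?thesis
      unfolding 2 corner_valuation_simps equivariant_bijections_def
      by (auto simp: equivariant_def intro!: partial_bijectionI)
  next
    case 3
    have l: "g l \<in> carrier G" using g by auto
    note tb = total_bijectionD[OF T.total_rep[OF l]]
    have "equivariant G (image_rel (Pair (1::nat)) (translation_rel G (g l)))"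
      unfolding equivariant_def image_rel_iff translation_rel_def using l by (auto simp: m_assoc)
    moreover have "partial_bijection (image_rel (Pair (1::nat)) (translation_rel G (g l)))"
      by (rule partial_bijection_image_rel[OF _ tb(4,1)]) (simp add: inj_on_def)
    moreover have "image_rel (Pair (1::nat)) (translation_rel G (g l)) \<subseteq>
        ({1..n} \<times> carrier G) \<times> ({1..n} \<times> carrier G)"
      using tb(4) n unfolding image_rel_def by force
    ultimately show ?thesis
      unfolding 3 corner_valuation_simps(3) by (simp add: equivariant_bijections_def)
  qed
qed

lemma corner_valuation_seed:
  assumes n: "0 < n"
  shows "seed_set (corner_valuation G n g) n = {1} \<times> carrier G"
proof -
  let ?V = "corner_valuation G n g"
  have pow: "Id_on (Domain (?V 1)) O ?V 0 ^^ m =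
      {((j, u), (j + m, u)) | j u. 1 \<le> j \<and> j + m \<le> n \<and> u \<in> carrier G}" for m
  proof (induction m)
    case 0 show ?case unfolding corner_valuation_simps by auto
  next
    case (Suc m)
    have "Id_on (Domain (?V 1)) O ?V 0 ^^ Suc m = (Id_on (Domain (?V 1)) O ?V 0 ^^ m) O ?V 0"
      by (simp add: O_assoc)
    also have "\<dots> = {((j, u), (j + m, u)) | j u. 1 \<le> j \<and> j + m \<le> n \<and> u \<in> carrier G} O ?V 0"
      unfolding Suc ..
    also have "\<dots> = {((j, u), (j + Suc m, u)) | j u. 1 \<le> j \<and> j + Suc m \<le> n \<and> u \<in> carrier G}"
      unfolding corner_valuation_simps(1) by force
    finally show ?case .
  qed
  have "Domain {((j, u), (j + (n - 1), u)) | j u. 1 \<le> j \<and> j + (n - 1) \<le> n \<and> u \<in> carrier G} =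
      {1} \<times> carrier G" (is "Domain ?D = _")
  proof (intro equalityI subsetI)
    fix x assume "x \<in> {1 :: nat} \<times> carrier G"
    then obtain u where "x = (1, u)" "u \<in> carrier G" by blast
    with n have "(x, (1 + (n - 1), u)) \<in> ?D" by auto
    then show "x \<in> Domain ?D" by (rule DomainI)
  qed auto
  moreover have "(1, u) \<notin> Range (?V 0)" for u
    unfolding corner_valuation_simps(1) by auto
  ultimately show ?thesis unfolding seed_set_def pow by auto
qed

text \<open>The set \<open>{1} \<times> G\<close> is already stable, so the number of rounds does not matter, and the corner
  carries the left regular representation of \<open>G\<close>.\<close>

lemma corner_identity_reflects:
  assumes sat: "bias_satisfies (rook_matrices n (group0 G))
      {(relativize (corner_term r n t) p, relativize (corner_term r n t) q)}"
    and n: "0 < n" and r: "var_bound p \<le> r" "var_bound q \<le> r"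
  shows "group_satisfies G {(p, q)}"
proof -
  interpret T: permutation_representation G "carrier G" "translation_rel G"
    by (rule translation_representation)
  have "group_eval G g p = group_eval G g q" if g: "range g \<subseteq> carrier G" for g
  proof -
    let ?V = "corner_valuation G n g" and ?A = "{1 :: nat} \<times> carrier G"
    \<comment> \<open>Beyond the bound \<open>r\<close> the restricted variables are the identity of the corner, that is,
      the action of the neutral element.\<close>
    define g' where "g' k = (if k < r then g k else \<one>)" for k
    have g': "range g' \<subseteq> carrier G" using g by (auto simp: g'_def)
    note Veq = corner_valuation_equivariant[OF n g]
    note pb = equivariant_bijectionsD(1)[OF Veq]
    have tb: "total_bijection (carrier G) (translation_rel G (g' k))" for k
      using T.total_rep g' by blast
    have gk: "translation_rel G (g k) \<subseteq> carrier G \<times> carrier G" "Domain (translation_rel G (g k)) = carrier G"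
      "Range (translation_rel G (g k)) = carrier G" for k
      using total_bijectionD[OF T.total_rep[of "g k"]] g by blast+
    have A: "Pair 1 ` carrier G = ?A" by auto
    have Vk: "Domain (?V (k + 2)) = ?A" "Range (?V (k + 2)) = ?A" for k
      unfolding corner_valuation_simps(3) Domain_image_rel Range_image_rel gk A by simp_all
    have stable: "shrink ?V r ?A = ?A"
      unfolding shrink_def using Vk by blast
    have "(shrink ?V r ^^ s) (seed_set ?V n) = ?A" for s
      by (induction s) (use stable in \<open>simp_all add: corner_valuation_seed[OF n]\<close>)
    then have c: "bias_rel ?V (corner_term r n t) = Id_on ?A"
      using bias_rel_corner_term[where V = ?V, OF pb] by simp
    have "corner_perm ?V r ?A k = image_rel (Pair 1) (translation_rel G (g' k))" for k
    proof (cases "k < r")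
      case True
      have "R \<subseteq> Domain R \<times> Range R" for R :: "((nat \<times> 'g) \<times> (nat \<times> 'g)) set" by auto
      from this[of "?V (k + 2)"] have "?V (k + 2) \<subseteq> ?A \<times> ?A" unfolding Vk .
      then show ?thesis using True corner_valuation_simps(3)[of G n g k]
        by (simp add: corner_perm_def g'_def Int_absorb2)
    next
      case False
      then show ?thesis by (simp add: corner_perm_def g'_def T.rep_one image_rel_Id_on A[simplified])
    qed
    then have P: "corner_perm ?V r ?A = (\<lambda>k. image_rel (Pair 1) (translation_rel G (g' k)))" ..
    have inj: "inj_on (Pair (1 :: nat)) (carrier G)" by (simp add: inj_on_def)
    note sub = total_bijectionD(4)[OF tb]
    note grp_sub = total_bijectionD(4)[OF
        total_bijection_grp_rel[where V = "\<lambda>k. translation_rel G (g' k)", OF tb]]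
    have ev: "bias_rel ?V (relativize (corner_term r n t) w) =
        image_rel (Pair 1) (grp_rel (carrier G) (\<lambda>k. translation_rel G (g' k)) w)"
      if "var_bound w \<le> r" for w
      using grp_rel_image[where V = "\<lambda>k. translation_rel G (g' k)", OF inj sub]
      unfolding bias_rel_relativize[where V = ?V, OF pb c stable that] P A .
    have "range ?V \<subseteq> equivariant_bijections G {1..n}" using Veq by blast
    with sat have "bias_rel ?V (relativize (corner_term r n t) p) = bias_rel ?V (relativize (corner_term r n t) q)"
      unfolding rook_matrices_satisfies_iff by blast
    then have "grp_rel (carrier G) (\<lambda>k. translation_rel G (g' k)) p =
        grp_rel (carrier G) (\<lambda>k. translation_rel G (g' k)) q"
      unfolding ev[OF r(1)] ev[OF r(2)]
      by (rule inj_on_image_rel[OF inj grp_sub grp_sub])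
    then have "group_eval G g' p = group_eval G g' q" unfolding T.group_eval_eq_iff[OF g'] .
    moreover have "group_eval G g' w = group_eval G g w" if "var_bound w \<le> r" for w
      using that by (intro group_eval_cong) (simp add: g'_def)
    ultimately show ?thesis using r by simp
  qed
  then show ?thesis by (simp add: group_satisfies_def)
qed

text \<open>The seed set has \<open>n\<close> disjoint translates, for which there is no room in an order below \<open>n\<close>. As the
  identity fails in order \<open>n\<close>, it separates that order from all smaller ones.\<close>

lemma seed_identity_holds:
  assumes "N < n"
  shows "bias_satisfies (rook_matrices N (group0 G)) {(seed_term n, BZero)}"
proof -
  have "bias_rel V (seed_term n) = {}" if V: "range V \<subseteq> equivariant_bijections G {1..N}" for V
  proof -
    have Vk: "V k \<in> equivariant_bijections G {1..N}" for k using V by blast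
    let ?T = "{j. (j, \<one>) \<in> seed_set V n}"
    have s: "bias_rel V (seed_term n) = Id_on (seed_set V n)"
      by (rule bias_rel_seed_term[OF equivariant_bijectionsD(1)[OF Vk]])
    with bias_rel_equivariant[OF V, of "seed_term n"]
    have I: "Id_on (seed_set V n) \<in> equivariant_bijections G {1..N}" by simp
    have TN: "?T \<subseteq> {1..N}" using equivariant_bijectionsD(3)[OF I] by auto
    then have "card ?T * n \<le> N"
      using assms by (intro card_seed_set[where V = V and N = N and n = n, OF Vk]) auto
    with assms have "card ?T = 0" by (cases "card ?T") auto
    moreover have "finite ?T" using TN finite_subset by blast
    ultimately have "seed_set V n = {}" using equivariant_diagonal[OF I] by simp
    with s show ?thesis by simp
  qed
  then show ?thesis unfolding rook_matrices_satisfies_iff by simp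
qed

lemma seed_identity_fails:
  assumes n: "0 < n"
  shows "\<not> bias_satisfies (rook_matrices n (group0 G)) {(seed_term n, BZero)}"
proof
  assume sat: "bias_satisfies (rook_matrices n (group0 G)) {(seed_term n, BZero)}"
  let ?V = "corner_valuation G n (\<lambda>_. \<one>)"
  have V: "?V k \<in> equivariant_bijections G {1..n}" for k
    by (rule corner_valuation_equivariant[OF n]) auto
  then have "bias_rel ?V (seed_term n) = {}"
    using sat unfolding rook_matrices_satisfies_iff by fastforce
  then have "{1 :: nat} \<times> carrier G = {}"
    unfolding bias_rel_seed_term[where V = ?V, OF equivariant_bijectionsD(1)[OF V]]
      corner_valuation_seed[OF n] by auto
  then show False using one_closed by blast
qed

end

section \<open>Generated varieties\<close>

lemma bias_satisfies_iff_singletons: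
  "bias_satisfies S \<Sigma> \<longleftrightarrow> (\<forall>(s, t) \<in> \<Sigma>. bias_satisfies S {(s, t)})"
  unfolding bias_satisfies_def by auto

lemma group_satisfies_iff_singletons:
  "group_satisfies H \<Sigma> \<longleftrightarrow> (\<forall>(s, t) \<in> \<Sigma>. group_satisfies H {(s, t)})"
  unfolding group_satisfies_def by auto

text \<open>The empty set of identities defines a variety as well, so membership in a generated variety
  includes being a Boolean inverse semigroup.\<close>

lemma bias_variety_generated_iff:
  "S \<in> bias_variety_generated K \<longleftrightarrow> boolean_inverse_semigroup S \<and>
    (\<forall>s t. (\<forall>T \<in> K. bias_satisfies T {(s, t)}) \<longrightarrow> bias_satisfies S {(s, t)})" (is "?L \<longleftrightarrow> ?R")
proof
  assume L: ?L
  then have *: "S \<in> bias_variety \<Sigma>" if "\<forall>T \<in> K. bias_satisfies T \<Sigma>" for \<Sigma>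
    using that unfolding bias_variety_generated_def by blast
  from *[of "{}"] have "boolean_inverse_semigroup S"
    by (simp add: bias_variety_def bias_satisfies_def)
  with * show ?R unfolding bias_variety_def by blast
next
  assume R: ?R
  have "S \<in> bias_variety \<Sigma>" if \<Sigma>: "\<forall>T \<in> K. bias_satisfies T \<Sigma>" for \<Sigma>
  proof -
    have "\<forall>T \<in> K. bias_satisfies T {(s, t)}" if "(s, t) \<in> \<Sigma>" for s t
      using \<Sigma> that bias_satisfies_iff_singletons by blast
    with R have "bias_satisfies S {(s, t)}" if "(s, t) \<in> \<Sigma>" for s t using that by blast
    then have "bias_satisfies S \<Sigma>" using bias_satisfies_iff_singletons by blast
    with R show ?thesis by (simp add: bias_variety_def)
  qed
  then show ?L unfolding bias_variety_generated_def by blast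
qed

lemma group_variety_generated_iff:
  "H \<in> group_variety_generated K \<longleftrightarrow> group H \<and>
    (\<forall>s t. (\<forall>T \<in> K. group_satisfies T {(s, t)}) \<longrightarrow> group_satisfies H {(s, t)})" (is "?L \<longleftrightarrow> ?R")
proof
  assume L: ?L
  then have *: "H \<in> group_variety \<Sigma>" if "\<forall>T \<in> K. group_satisfies T \<Sigma>" for \<Sigma>
    using that unfolding group_variety_generated_def by blast
  from *[of "{}"] have "group H" by (simp add: group_variety_def group_satisfies_def)
  with * show ?R unfolding group_variety_def by blast
next
  assume R: ?R
  have "H \<in> group_variety \<Sigma>" if \<Sigma>: "\<forall>T \<in> K. group_satisfies T \<Sigma>" for \<Sigma>
  proof -
    have "\<forall>T \<in> K. group_satisfies T {(s, t)}" if "(s, t) \<in> \<Sigma>" for s t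
      using \<Sigma> that group_satisfies_iff_singletons by blast
    with R have "group_satisfies H {(s, t)}" if "(s, t) \<in> \<Sigma>" for s t using that by blast
    then have "group_satisfies H \<Sigma>" using group_satisfies_iff_singletons by blast
    with R show ?thesis by (simp add: group_variety_def)
  qed
  then show ?L unfolding group_variety_generated_def by blast
qed

theorem lemma10p3:
  fixes I :: "'i set" and ns :: "'i \<Rightarrow> nat" and Gs :: "'i \<Rightarrow> 'g monoid"
    and n :: nat and G :: "'h monoid"
  assumes "I \<noteq> {}"
    and "bdd_above (ns ` I)"
    and "\<And>i. i \<in> I \<Longrightarrow> 0 < ns i"
    and "\<And>i. i \<in> I \<Longrightarrow> group (Gs i)"
    and "0 < n"
    and "group G"
  shows "rook_matrices n (group0 G) \<in>
      bias_variety_generated {rook_matrices (ns i) (group0 (Gs i)) | i. i \<in> I} \<longleftrightarrow>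
    (\<exists>o' \<in> I. n \<le> ns o') \<and>
    G \<in> group_variety_generated {wreath_sym (Gs i) (ns i div n) | i. i \<in> I \<and> n \<le> ns i}"
    (is "?L \<longleftrightarrow> ?R")
proof
  interpret G: plain_group G using assms(6) by (simp add: plain_group_def)
  have Gs: "plain_group (Gs i)" if "i \<in> I" for i using assms(4)[OF that] by (simp add: plain_group_def)
  {
    assume ?L
    then have id: "bias_satisfies (rook_matrices n (group0 G)) {(s, t)}"
      if "\<And>i. i \<in> I \<Longrightarrow> bias_satisfies (rook_matrices (ns i) (group0 (Gs i))) {(s, t)}" for s t
      using that unfolding bias_variety_generated_iff by blast
    have "\<exists>o' \<in> I. n \<le> ns o'"
    proof (rule ccontr)
      assume "\<not> ?thesis"
      then have "ns i < n" if "i \<in> I" for i using that by auto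
      then have "bias_satisfies (rook_matrices n (group0 G)) {(seed_term n, BZero)}"
        by (intro id plain_group.seed_identity_holds Gs) auto
      with G.seed_identity_fails[OF assms(5)] show False ..
    qed
    moreover have "group_satisfies G {(p, q)}"
      if pq: "\<And>i. i \<in> I \<Longrightarrow> n \<le> ns i \<Longrightarrow> group_satisfies (wreath_sym (Gs i) (ns i div n)) {(p, q)}"
      for p q
    proof -
      obtain B where B: "\<And>i. i \<in> I \<Longrightarrow> ns i \<le> B" using assms(2) unfolding bdd_above_def by auto
      define r where "r = max (var_bound p) (var_bound q)"
      have "bias_satisfies (rook_matrices n (group0 G))
          {(relativize (corner_term r n B) p, relativize (corner_term r n B) q)}"
        by (rule id, rule plain_group.corner_identity_holds[OF Gs])
          (use pq B assms(5) in \<open>auto simp: r_def\<close>)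
      then show ?thesis
        by (rule G.corner_identity_reflects) (simp_all add: assms(5) r_def)
    qed
    ultimately show ?R using assms(6) unfolding group_variety_generated_iff by blast
  next
    assume R: ?R
    then obtain m where m: "m \<in> I" "n \<le> ns m" by blast
    have id: "group_satisfies G {(p, q)}"
      if "\<And>i. i \<in> I \<Longrightarrow> n \<le> ns i \<Longrightarrow> group_satisfies (wreath_sym (Gs i) (ns i div n)) {(p, q)}" for p q
      using R that unfolding group_variety_generated_iff by blast
    have "bias_satisfies (rook_matrices n (group0 G)) {(s, t)}"
      if st: "\<And>i. i \<in> I \<Longrightarrow> bias_satisfies (rook_matrices (ns i) (group0 (Gs i))) {(s, t)}" for s t
    proof (rule G.rook_satisfies_from_patterns)
      fix \<pi> :: "nat \<Rightarrow> pattern" and i j :: nat and u :: "nat \<Rightarrow> 'h"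
      assume \<pi>: "\<And>l. rook_pattern (\<pi> l)"
        and supp: "\<And>l i j w. \<pi> l (i, j) = Some w \<Longrightarrow> i \<in> {1..n} \<and> j \<in> {1..n}"
        and u: "range u \<subseteq> carrier G"
      have W: "rel_option (\<lambda>p q. group_eval (wreath_sym (Gs a) (ns a div n)) v p =
          group_eval (wreath_sym (Gs a) (ns a div n)) v q) (bias_pattern \<pi> s (i, j)) (bias_pattern \<pi> t (i, j))"
        if a: "a \<in> I" "n \<le> ns a" and v: "range v \<subseteq> carrier (wreath_sym (Gs a) (ns a div n))" for a v
        by (rule plain_group.pattern_identities[OF Gs[OF a(1)] st[OF a(1)] _ _ \<pi> supp v])
          (use a(2) assms(5) in \<open>auto simp: div_greater_zero_iff\<close>)
      interpret W: permutation_representation "wreath_sym (Gs m) (ns m div n)"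
        "{1..ns m div n} \<times> carrier (Gs m)" "wreath_rel (Gs m) (ns m div n)"
        by (rule plain_group.wreath_representation[OF Gs[OF m(1)]])
      \<comment> \<open>A single order that is at least \<open>n\<close> shows that the zero patterns agree; the group identities at the
        nonzero entries come from all such orders.\<close>
      have pat: "rel_option (\<lambda>_ _. True) (bias_pattern \<pi> s (i, j)) (bias_pattern \<pi> t (i, j))"
        using W[OF m, of "\<lambda>_. \<one>\<^bsub>wreath_sym (Gs m) (ns m div n)\<^esub>"] W.one_closed
        by (auto elim!: option.rel_mono_strong)
      show "rel_option (\<lambda>p q. group_eval G u p = group_eval G u q)
        (bias_pattern \<pi> s (i, j)) (bias_pattern \<pi> t (i, j))"
      proof (cases "bias_pattern \<pi> s (i, j)"; cases "bias_pattern \<pi> t (i, j)")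
        fix p q assume pq: "bias_pattern \<pi> s (i, j) = Some p" "bias_pattern \<pi> t (i, j) = Some q"
        have "group_satisfies G {(p, q)}"
        proof (rule id)
          fix a assume "a \<in> I" "n \<le> ns a"
          from W[OF this] show "group_satisfies (wreath_sym (Gs a) (ns a div n)) {(p, q)}"
            unfolding pq group_satisfies_def by simp
        qed
        with u pq show ?thesis by (simp add: group_satisfies_def)
      qed (use pat in auto)
    qed
    with G.rook_matrices_boolean show ?L unfolding bias_variety_generated_iff by blast
  }
qed

end
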